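(* For all $\tau\in\mathbb{H}$ and $z\in\mathbb{C}$ with $\theta_1(z|\tau)\theta_2(z|\tau)\neq0$, writing $\theta_k=\theta_k(z|\tau)$, $\theta_1'=\theta_1'(z|\tau)$, $\vartheta_k=\vartheta_k(\tau)$, $\eta=\eta(\tau)$ and $\Lambda_0=\eta+\frac{\pi^2}{12}(\vartheta_3^4+\vartheta_4^4)$: $$\frac{\partial\theta_1}{\partial\tau}=\frac{-i}{4\pi}\frac{\theta_1'^2}{\theta_1}+\frac{i}{4}\pi\vartheta_3^2\vartheta_4^2\frac{\theta_2^2}{\theta_1}+\frac{i}{\pi}\Lambda_0\theta_1,$$ $$\frac{\partial\theta_2}{\partial\tau}=\frac{-i}{4\pi}\Big\{\frac{\theta_1'}{\theta_1}-\pi\vartheta_2^2\frac{\theta_3\theta_4}{\theta_1\theta_2}\Big\}^2\theta_2+\frac{i}{4}\pi\vartheta_3^2\vartheta_4^2\frac{\theta_1^2}{\theta_2}+\frac{i}{\pi}\Lambda_0\theta_2,$$ $$\frac{\partial\theta_3}{\partial\tau}=\frac{-i}{4\pi}\frac{\theta_1'^2}{\theta_1^2}\theta_3+\frac{i}{2}\vartheta_3^2\theta_1'\frac{\theta_2\theta_4}{\theta_1^2}-\frac{i}{4}\pi\vartheta_2^2\vartheta_3^2\frac{\theta_4^2}{\theta_1^2}\theta_3+\frac{i}{\pi}\Lambda_0\theta_3,$$ $$\frac{\partial\theta_4}{\partial\tau}=\frac{-i}{4\pi}\frac{\theta_1'^2}{\theta_1^2}\theta_4+\frac{i}{2}\vartheta_4^2\theta_1'\frac{\theta_2\theta_3}{\theta_1^2}-\frac{i}{4}\pi\vartheta_2^2\vartheta_4^2\frac{\theta_3^2}{\theta_1^2}\theta_4+\frac{i}{\pi}\Lambda_0\theta_4,$$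 $$\frac{\partial\theta_1'}{\partial\tau}=\frac{-i}{4\pi}\frac{\theta_1'^3}{\theta_1^2}+\frac{3i}{\pi}\Big\{\frac{\pi^2}{4}\vartheta_3^2\vartheta_4^2\frac{\theta_2^2}{\theta_1^2}+\Lambda_0\Big\}\theta_1'-\frac{i}{2}\pi^2\vartheta_2^2\vartheta_3^2\vartheta_4^2\frac{\theta_2\theta_3\theta_4}{\theta_1^2}.$$
   Context: $\mathbb{H}=\{\Im\tau>0\}$. $\theta_1(z|\tau)=2e^{\pi i\tau/4}\sum_{k\ge0}(-1)^ke^{(k^2+k)\pi i\tau}\sin((2k+1)\pi z)$, $\theta_2(z|\tau)=2e^{\pi i\tau/4}\sum_{k\ge0}e^{(k^2+k)\pi i\tau}\cos((2k+1)\pi z)$, $\theta_3(z|\tau)=1+2\sum_{k\ge1}e^{k^2\pi i\tau}\cos(2k\pi z)$, $\theta_4(z|\tau)=1+2\sum_{k\ge1}(-1)^ke^{k^2\pi i\tau}\cos(2k\pi z)$; $\theta_1'=\partial_z\theta_1$; $\vartheta_k(\tau)=\theta_k(0|\tau)$; $\eta(\tau)=2\pi^2\{\frac1{24}-\sum_{k\ge1}\frac{e^{2k\pi i\tau}}{(1-e^{2k\pi i\tau})^2}\}$. *)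

theory Defs
  imports "HOL-Complex_Analysis.Complex_Analysis"
begin

definition theta1 :: "complex \<Rightarrow> complex \<Rightarrow> complex" where
  "theta1 (z::complex) (\<tau>::complex) = 2 * exp (of_real pi * \<i> * \<tau> / 4) *
     (\<Sum>k. (-1) ^ k * exp (of_nat (k^2 + k) * of_real pi * \<i> * \<tau>) * sin ((2 * of_nat k + 1) * of_real pi * z))"

definition theta2 :: "complex \<Rightarrow> complex \<Rightarrow> complex" where
  "theta2 (z::complex) (\<tau>::complex) = 2 * exp (of_real pi * \<i> * \<tau> / 4) *
     (\<Sum>k. exp (of_nat (k^2 + k) * of_real pi * \<i> * \<tau>) * cos ((2 * of_nat k + 1) * of_real pi * z))"

definition theta3 :: "complex \<Rightarrow> complex \<Rightarrow> complex" where
  "theta3 (z::complex) (\<tau>::complex) = 1 + 2 *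
     (\<Sum>k. exp (of_nat ((Suc k)^2) * of_real pi * \<i> * \<tau>) * cos (2 * of_nat (Suc k) * of_real pi * z))"

definition theta4 :: "complex \<Rightarrow> complex \<Rightarrow> complex" where
  "theta4 (z::complex) (\<tau>::complex) = 1 + 2 *
     (\<Sum>k. (-1) ^ (Suc k) * exp (of_nat ((Suc k)^2) * of_real pi * \<i> * \<tau>) * cos (2 * of_nat (Suc k) * of_real pi * z))"

definition theta1' :: "complex \<Rightarrow> complex \<Rightarrow> complex" where
  "theta1' z \<tau> = deriv (\<lambda>w. theta1 w \<tau>) z"

definition vtheta2 :: "complex \<Rightarrow> complex" where "vtheta2 \<tau> = theta2 0 \<tau>"
definition vtheta3 :: "complex \<Rightarrow> complex" where "vtheta3 \<tau> = theta3 0 \<tau>"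
definition vtheta4 :: "complex \<Rightarrow> complex" where "vtheta4 \<tau> = theta4 0 \<tau>"

definition eta :: "complex \<Rightarrow> complex" where
  "eta \<tau> = 2 * of_real pi ^ 2 * (1/24 - (\<Sum>k. exp (2 * of_nat (Suc k) * of_real pi * \<i> * \<tau>) /
        (1 - exp (2 * of_nat (Suc k) * of_real pi * \<i> * \<tau>))^2))"

definition Lambda0 :: "complex \<Rightarrow> complex" where
  "Lambda0 \<tau> = eta \<tau> + of_real pi ^ 2 / 12 * (vtheta3 \<tau> ^ 4 + vtheta4 \<tau> ^ 4)"

end

theory Submission
  imports Defs
begin

text \<open>
  Each \<open>\<theta>\<^sub>i\<close> satisfies the heat equation \<open>4 \<pi> i \<partial>\<^sub>\<tau> \<theta> = \<theta>''\<close>, so only second derivatives in \<open>z\<close>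
  have to be expressed. Comparing quasi-periods with a product vanishing simply on the lattice locates the
  zeros of the \<open>\<theta>\<^sub>i\<close>; an entire function with the quasi-periods and the zeros of a product of theta functions
  is a multiple of it, by Liouville. This gives the Wronskians \<open>\<theta>\<^sub>1' \<theta>\<^sub>j - \<theta>\<^sub>j' \<theta>\<^sub>1\<close> and writes
  \<open>\<theta>\<^sub>1 \<theta>\<^sub>1'' - \<theta>\<^sub>1'\<^sup>2\<close> as a combination of \<open>\<theta>\<^sub>1\<^sup>2\<close> and \<open>\<theta>\<^sub>2\<^sup>2\<close>. The constants are Taylor coefficients at \<open>0\<close>:
  Jacobi's formula \<open>\<theta>\<^sub>1'(0) = \<pi> \<vartheta>\<^sub>2 \<vartheta>\<^sub>3 \<vartheta>\<^sub>4\<close> holds because the ratio of the two sides has derivative \<open>0\<close> in \<open>\<tau>\<close>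
  and the right limit at \<open>i \<infinity>\<close>, and the product gives \<open>\<theta>\<^sub>1'''(0) = - 12 \<eta> \<theta>\<^sub>1'(0)\<close>.
\<close>

section \<open>Theta series with characteristics\<close>

text \<open>The zeros come from a product because quasi-periodicity and parity only show that
  theta_1 vanishes on the lattice; that it vanishes nowhere else, and only simply, is visible on the
  factors of the product. The zeros of the Wronskians come from symmetry: an even function whose
  multiplier along a period is -1 vanishes at half that period. Jacobi's formula is itself a
  consequence of the Wronskian identities, so these are first proved with the unevaluated constant
  \<open>jacobi_ratio\<close>. Differentiating one of them twice at 0 gives theta_1'''/theta_1' =
  theta_2''/theta_2 + theta_3''/theta_3 + theta_4''/theta_4 at 0, which is exactly what makes the
  ratio constant in tau. This sum rule also produces \<open>Lambda0\<close>. At 0 the ratios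
  theta_3''/theta_3 and theta_4''/theta_4 exceed theta_2''/theta_2 by pi^2 times the fourth power of
  \<open>vtheta4\<close> and of \<open>vtheta3\<close> respectively, and the sum is -12
  \<open>eta\<close>; solving for theta_2''/theta_2 gives -4 \<open>Lambda0\<close>. The Lambert
  series in \<open>eta\<close> appears as a second logarithmic derivative of the product.\<close>

definition theta_term :: "nat \<Rightarrow> real \<Rightarrow> int \<Rightarrow> complex \<Rightarrow> complex \<Rightarrow> complex" where
  "theta_term m a n z t = (2 * of_real pi * \<i> * (of_int n + of_real a)) ^ m *
     exp (of_real pi * \<i> * ((of_int n + of_real a)\<^sup>2 * t + 2 * (of_int n + of_real a) * z))"

text \<open>The sum runs over all integers, paired as \<open>k\<close> and \<open>-k-1\<close>; the index \<open>m\<close> counts derivatives in \<open>z\<close>.\<close>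

definition theta_char :: "nat \<Rightarrow> real \<Rightarrow> complex \<Rightarrow> complex \<Rightarrow> complex" where
  "theta_char m a z t = (\<Sum>k. theta_term m a (int k) z t + theta_term m a (- int k - 1) z t)"

section \<open>Domination and termwise differentiation of the series\<close>

lemma power_le_fact_mult_exp:
  fixes x :: real
  assumes "0 \<le> x"
  shows "x ^ m \<le> fact m * exp x"
proof -
  have s: "(\<lambda>n. x ^ n /\<^sub>R fact n) sums exp x" by (rule exp_converges)
  have "(\<Sum>n\<in>{m}. x ^ n /\<^sub>R fact n) \<le> (\<Sum>n. x ^ n /\<^sub>R fact n)"
    using s assms by (intro sum_le_suminf) (auto simp: sums_iff)
  also have "\<dots> = exp x" using s by (simp add: sums_iff)
  finally show ?thesis by (simp add: field_simps)
qed

text \<open>Gaussian decay beats the linear exponent in \<open>z\<close> and the power from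
  differentiation. The bound is uniform for \<open>z\<close> in a disc and \<open>t\<close> in a
  half-plane away from the real axis, so it serves for derivatives in either variable.\<close>

lemma norm_theta_term_le:
  assumes "cmod z \<le> R" "d \<le> Im t" "0 < d" "real k \<le> \<bar>n + a\<bar>"
  shows "cmod (theta_term m a n z t) \<le> fact m * exp ((2 * pi * (R + 1) + 1)\<^sup>2 / (4 * pi * d)) * exp (- real k)"
proof -
  define s where "s = real_of_int n + a"
  \<comment> \<open>Total linear growth in |s|: 2 pi R from the exponential in \<open>z\<close>, 2
    pi from the power once it is absorbed into an exponential, and 1 that is set aside for the decay
    exp(-k). Completing the square then removes \<open>B\<close>.\<close>
  define B where "B = 2 * pi * (R + 1) + 1"
  have e: "cmod (theta_term m a n z t) = (2 * pi * \<bar>s\<bar>) ^ m * exp (- pi * s\<^sup>2 * Im t - 2 * pi * (s * Im z))"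
  proof -
    have 1: "complex_of_int n + complex_of_real a = complex_of_real s" by (simp add: s_def)
    show ?thesis unfolding theta_term_def 1
      by (simp add: norm_mult norm_power norm_exp_eq_Re power2_eq_square algebra_simps)
  qed
  have m: "(2 * pi * \<bar>s\<bar>) ^ m \<le> fact m * exp (2 * pi * \<bar>s\<bar>)"
    by (rule power_le_fact_mult_exp) simp
  have z: "- (s * Im z) \<le> \<bar>s\<bar> * R"
  proof -
    have "- (s * Im z) \<le> \<bar>s\<bar> * \<bar>Im z\<bar>" by (simp add: abs_mult[symmetric])
    also have "\<dots> \<le> \<bar>s\<bar> * R" using abs_Im_le_cmod[of z] assms(1) by (intro mult_left_mono) auto
    finally show ?thesis .
  qed
  have t: "- (pi * s\<^sup>2 * Im t) \<le> - (pi * s\<^sup>2 * d)"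
    using assms by (simp add: mult_left_mono)
  have q: "- pi * s\<^sup>2 * d + B * \<bar>s\<bar> \<le> B\<^sup>2 / (4 * pi * d)"
  proof -
    have "0 \<le> (2 * pi * d * \<bar>s\<bar> - B)\<^sup>2 / (4 * pi * d)" using assms by simp
    also have "\<dots> = pi * d * \<bar>s\<bar>\<^sup>2 - B * \<bar>s\<bar> + B\<^sup>2 / (4 * pi * d)"
      using assms by (simp add: field_simps power2_eq_square)
    finally show ?thesis by (simp add: algebra_simps)
  qed
  have "cmod (theta_term m a n z t) \<le> (fact m * exp (2 * pi * \<bar>s\<bar>)) * exp (- pi * s\<^sup>2 * d + 2 * pi * (\<bar>s\<bar> * R))"
    unfolding e
  proof (rule mult_mono[OF m])
    have "2 * pi * (- (s * Im z)) \<le> 2 * pi * (\<bar>s\<bar> * R)" by (rule mult_left_mono[OF z]) simp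
    then show "exp (- pi * s\<^sup>2 * Im t - 2 * pi * (s * Im z)) \<le> exp (- pi * s\<^sup>2 * d + 2 * pi * (\<bar>s\<bar> * R))"
      unfolding exp_le_cancel_iff using t by linarith
  qed auto
  also have "\<dots> = fact m * exp (- pi * s\<^sup>2 * d + B * \<bar>s\<bar> - \<bar>s\<bar>)"
    by (simp add: B_def exp_add[symmetric] algebra_simps flip: exp_add)
  also have "\<dots> \<le> fact m * exp (B\<^sup>2 / (4 * pi * d) - real k)"
    using q assms(4) by (intro mult_left_mono) (auto simp: s_def)
  finally show ?thesis by (simp add: B_def exp_diff exp_minus field_simps)
qed

lemma summable_exp_minus_nat: "summable (\<lambda>k. C * exp (- real k))"
proof -
  have "summable (\<lambda>k. (exp (-1::real)) ^ k)" by (rule summable_geometric) simp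
  then have "summable (\<lambda>k. C * (exp (-1::real)) ^ k)" by (rule summable_mult)
  moreover have "(\<lambda>k. C * (exp (-1::real)) ^ k) = (\<lambda>k. C * exp (- real k))"
    by (auto simp: exp_of_nat_mult[symmetric])
  ultimately show ?thesis by simp
qed

definition theta_bound :: "nat \<Rightarrow> real \<Rightarrow> real \<Rightarrow> nat \<Rightarrow> real" where
  "theta_bound m R d k = fact m * exp ((2 * pi * (R + 1) + 1)\<^sup>2 / (4 * pi * d)) * exp (- real k)"

lemma summable_theta_bound: "summable (theta_bound m R d)"
  unfolding theta_bound_def by (rule summable_exp_minus_nat)

lemma theta_bound_nonneg: "0 \<le> theta_bound m R d k"
  by (simp add: theta_bound_def)

lemma norm_theta_term_nonneg_le:
  assumes "cmod z \<le> R" "d \<le> Im t" "0 < d" "0 \<le> a"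
  shows "cmod (theta_term m a (int k) z t) \<le> theta_bound m R d k"
  unfolding theta_bound_def by (rule norm_theta_term_le) (use assms in auto)

lemma norm_theta_term_neg_le:
  assumes "cmod z \<le> R" "d \<le> Im t" "0 < d" "a \<le> 1"
  shows "cmod (theta_term m a (- int k - 1) z t) \<le> theta_bound m R d k"
  unfolding theta_bound_def by (rule norm_theta_term_le) (use assms in auto)

lemma summable_theta_term:
  assumes "Im t > 0" "0 \<le> a" "a \<le> 1"
  shows "summable (\<lambda>k. theta_term m a (int k) z t)" "summable (\<lambda>k. theta_term m a (- int k - 1) z t)"
  by (rule summable_comparison_test'[OF summable_theta_bound[of m "cmod z" "Im t"], of 0],
      use assms in \<open>auto intro!: norm_theta_term_nonneg_le norm_theta_term_neg_le\<close>)+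

lemma theta_char_eq_add:
  assumes "Im t > 0" "0 \<le> a" "a \<le> 1"
  shows "theta_char m a z t = (\<Sum>k. theta_term m a (int k) z t) + (\<Sum>k. theta_term m a (- int k - 1) z t)"
  unfolding theta_char_def using summable_theta_term[OF assms] by (rule suminf_add[symmetric])

lemma theta_term_dz:
  "((\<lambda>z. theta_term m a n z t) has_field_derivative theta_term (Suc m) a n z t) (at z)"
  unfolding theta_term_def
  by (rule derivative_eq_intros refl)+ (simp add: algebra_simps)

text \<open>The heat equation holds term by term, since pi i s^2 = (2 pi i s)^2 / (4 pi i).\<close>

lemma theta_term_dt:
  "((\<lambda>t. theta_term m a n z t) has_field_derivative theta_term (Suc (Suc m)) a n z t / (4 * of_real pi * \<i>)) (at t)"
  unfolding theta_term_def
  by (rule derivative_eq_intros refl)+ (simp add: field_simps power2_eq_square)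

text \<open>Weierstrass' theorem: for holomorphic terms, local domination of the terms themselves
  already allows termwise differentiation.\<close>

lemma has_field_derivative_suminf_dominated:
  fixes f :: "nat \<Rightarrow> complex \<Rightarrow> complex"
  assumes S: "open S" "x \<in> S"
    and hfd: "\<And>n x. x \<in> S \<Longrightarrow> (f n has_field_derivative f' n x) (at x)"
    and dom: "\<And>x. x \<in> S \<Longrightarrow> \<exists>d h. 0 < d \<and> summable h \<and> (\<forall>n y. y \<in> ball x d \<inter> S \<longrightarrow> cmod (f n y) \<le> h n)"
  shows "((\<lambda>x. \<Sum>n. f n x) has_field_derivative (\<Sum>n. f' n x)) (at x)"
proof -
  have "\<exists>g g'. \<forall>x \<in> S. ((\<lambda>n. f n x) sums g x) \<and> ((\<lambda>n. f' n x) sums g' x) \<and> (g has_field_derivative g' x) (at x)"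
  proof (rule series_and_derivative_comparison_local[OF S(1) hfd])
    fix x assume "x \<in> S"
    from dom[OF this] obtain d h where "0 < d" "summable h" "\<forall>n y. y \<in> ball x d \<inter> S \<longrightarrow> cmod (f n y) \<le> h n" by blast
    then show "\<exists>d h. 0 < d \<and> summable h \<and> (\<forall>\<^sub>F n in sequentially. \<forall>y\<in>ball x d \<inter> S. norm (f n y) \<le> h n)"
      by (intro exI[of _ d] exI[of _ h]) auto
  qed
  then obtain g g' where g: "\<And>x. x \<in> S \<Longrightarrow> (\<lambda>n. f n x) sums g x" "\<And>x. x \<in> S \<Longrightarrow> (\<lambda>n. f' n x) sums g' x"
      "\<And>x. x \<in> S \<Longrightarrow> (g has_field_derivative g' x) (at x)" by blast
  have "((\<lambda>x. \<Sum>n. f n x) has_field_derivative g' x) (at x)"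
    by (rule has_field_derivative_transform_within_open[OF g(3)[OF S(2)] S]) (use g(1) in \<open>auto simp: sums_iff\<close>)
  then show ?thesis using g(2)[OF S(2)] by (simp add: sums_iff)
qed

lemma theta_char_dz:
  assumes "Im t > 0" "0 \<le> a" "a \<le> 1"
  shows "((\<lambda>z. theta_char m a z t) has_field_derivative theta_char (Suc m) a z t) (at z)"
  unfolding theta_char_def
proof (rule has_field_derivative_suminf_dominated[of UNIV])
  fix x :: complex
  show "\<exists>d h. 0 < d \<and> summable h \<and> (\<forall>n y. y \<in> ball x d \<inter> UNIV \<longrightarrow>
          cmod (theta_term m a (int n) y t + theta_term m a (- int n - 1) y t) \<le> h n)"
  proof (intro exI conjI allI impI)
    show "summable (\<lambda>k. theta_bound m (cmod x + 1) (Im t) k + theta_bound m (cmod x + 1) (Im t) k)"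
      by (intro summable_add summable_theta_bound)
    fix n y assume "y \<in> ball x 1 \<inter> UNIV"
    then have "cmod y \<le> cmod x + 1" using norm_triangle_ineq2[of y x] by (simp add: dist_norm norm_minus_commute)
    then show "cmod (theta_term m a (int n) y t + theta_term m a (- int n - 1) y t)
       \<le> theta_bound m (cmod x + 1) (Im t) n + theta_bound m (cmod x + 1) (Im t) n"
      by (intro order_trans[OF norm_triangle_ineq] add_mono norm_theta_term_nonneg_le norm_theta_term_neg_le) (use assms in auto)
  qed simp
qed (auto intro!: derivative_eq_intros theta_term_dz)

lemma theta_char_dt:
  assumes "Im t > 0" "0 \<le> a" "a \<le> 1"
  shows "((\<lambda>t. theta_char m a z t) has_field_derivative theta_char (Suc (Suc m)) a z t / (4 * of_real pi * \<i>)) (at t)"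
proof -
  have "((\<lambda>t. theta_char m a z t) has_field_derivative
     (\<Sum>k. theta_term (Suc (Suc m)) a (int k) z t / (4 * of_real pi * \<i>) + theta_term (Suc (Suc m)) a (- int k - 1) z t / (4 * of_real pi * \<i>))) (at t)"
    unfolding theta_char_def
  proof (rule has_field_derivative_suminf_dominated[of "{t. Im t > 0}"])
    fix x :: complex assume x: "x \<in> {t. Im t > 0}"
    show "\<exists>d h. 0 < d \<and> summable h \<and> (\<forall>n y. y \<in> ball x d \<inter> {t. Im t > 0} \<longrightarrow>
            cmod (theta_term m a (int n) z y + theta_term m a (- int n - 1) z y) \<le> h n)"
    proof (intro exI conjI allI impI)
      show "summable (\<lambda>k. theta_bound m (cmod z) (Im x / 2) k + theta_bound m (cmod z) (Im x / 2) k)"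
        by (intro summable_add summable_theta_bound)
      fix n y assume "y \<in> ball x (Im x / 2) \<inter> {t. Im t > 0}"
      then have "Im x / 2 \<le> Im y" using abs_Im_le_cmod[of "x - y"] by (auto simp: dist_norm)
      then show "cmod (theta_term m a (int n) z y + theta_term m a (- int n - 1) z y)
         \<le> theta_bound m (cmod z) (Im x / 2) n + theta_bound m (cmod z) (Im x / 2) n"
        using assms x
        by (intro order_trans[OF norm_triangle_ineq] add_mono norm_theta_term_nonneg_le norm_theta_term_neg_le) auto
    qed (use x in simp)
  qed (auto intro!: derivative_eq_intros theta_term_dt simp: open_halfspace_Im_gt assms)
  also have "(\<Sum>k. theta_term (Suc (Suc m)) a (int k) z t / (4 * of_real pi * \<i>) + theta_term (Suc (Suc m)) a (- int k - 1) z t / (4 * of_real pi * \<i>))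
     = theta_char (Suc (Suc m)) a z t / (4 * of_real pi * \<i>)"
    unfolding theta_char_def add_divide_distrib[symmetric]
    by (intro suminf_divide summable_add summable_theta_term assms)
  finally show ?thesis .
qed

section \<open>Quasi-periods and parity of the series\<close>

lemma theta_char_1_shift:
  assumes "exp (2 * of_real pi * \<i> * of_real a) = c" and t: "Im t > 0" "0 \<le> a" "a \<le> 1"
  shows "theta_char m a (z + 1) t = c * theta_char m a z t"
proof -
  have "theta_term m a n (z + 1) t = c * theta_term m a n z t" for n
  proof -
    have "exp (2 * of_real pi * \<i> * of_int n) = 1"
      using exp_integer_2pi[of "of_int n"] by (simp add: algebra_simps)
    then have "exp (2 * of_real pi * \<i> * (of_int n + of_real a)) = c"
      using assms by (simp add: distrib_left exp_add)
    moreover have "exp (of_real pi * \<i> * ((of_int n + of_real a)\<^sup>2 * t + 2 * (of_int n + of_real a) * (z + 1)))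
      = exp (of_real pi * \<i> * ((of_int n + of_real a)\<^sup>2 * t + 2 * (of_int n + of_real a) * z)) *
        exp (2 * of_real pi * \<i> * (of_int n + of_real a))"
      by (simp add: exp_add[symmetric] algebra_simps)
    ultimately show ?thesis by (simp add: theta_term_def)
  qed
  then show ?thesis unfolding theta_char_def
    using suminf_mult[OF summable_add[OF summable_theta_term[OF t, of m z]], of c] by (simp add: distrib_left)
qed

text \<open>Reindexing n to n+1 in the two-sided sum destroys the pairing of k with -k-1; the term
  \<open>u 0\<close> passes from one half to the other, and the total stays the same.\<close>

lemma suminf_int_shift:
  fixes u :: "int \<Rightarrow> complex"
  assumes "summable (\<lambda>k. u (int k))" "summable (\<lambda>k. u (- int k - 1))"
  shows "(\<lambda>k. u (int k + 1) + u (- int k)) sums ((\<Sum>k. u (int k)) + (\<Sum>k. u (- int k - 1)))"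
proof -
  have "(\<lambda>k. u (int (Suc k))) sums ((\<Sum>k. u (int k)) - u (int 0))"
    using assms(1) by (subst sums_Suc_iff) (auto simp: summable_sums)
  then have 1: "(\<lambda>k. u (int k + 1)) sums ((\<Sum>k. u (int k)) - u 0)" by (simp add: add.commute)
  have "(\<lambda>k. u (- int (Suc k))) sums (\<Sum>k. u (- int k - 1))"
    using summable_sums[OF assms(2)] by (simp add: minus_diff_commute)
  then have 2: "(\<lambda>k. u (- int k)) sums ((\<Sum>k. u (- int k - 1)) + u 0)"
    by (subst (asm) sums_Suc_iff) simp
  from sums_add[OF 1 2] show ?thesis by simp
qed

text \<open>The automorphy factor common to all the theta series under translation by
  \<open>t\<close>; half-integer characteristics only add signs after a shift of \<open>z\<close> by
  1/2.\<close>

definition theta_mult :: "complex \<Rightarrow> complex \<Rightarrow> complex" where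
  "theta_mult t z = exp (- of_real pi * \<i> * t - 2 * of_real pi * \<i> * z)"

text \<open>Completing the square in the exponent turns the translation of \<open>z\<close> by
  \<open>t\<close> into the index shift n to n+1.\<close>

lemma theta_char_tau_shift:
  assumes "Im t > 0" "0 \<le> a" "a \<le> 1"
  shows "theta_char 0 a (z + t) t = theta_mult t z * theta_char 0 a z t"
proof -
  have "theta_term 0 a n (z + t) t = theta_mult t z * theta_term 0 a (n + 1) z t" for n
    unfolding theta_term_def theta_mult_def
    by (simp add: exp_add[symmetric] algebra_simps power2_eq_square)
  then have "theta_char 0 a (z + t) t = (\<Sum>k. theta_mult t z * (theta_term 0 a (int k + 1) z t + theta_term 0 a (- int k) z t))"
    unfolding theta_char_def by (simp add: distrib_left)
  also have "\<dots> = theta_mult t z * theta_char 0 a z t"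
    using sums_mult[OF suminf_int_shift[OF summable_theta_term[OF assms, of 0 z]], of "theta_mult t z"]
    by (simp add: theta_char_eq_add[OF assms] sums_iff)
  finally show ?thesis .
qed

text \<open>The reflection n to -n does not respect the pairing of k with -k-1, so the index shift
  is used once more. For characteristic 1/2 the reflection is n to -n-1, which merely swaps the
  members of each pair.\<close>

lemma theta_char_0_minus:
  assumes "Im t > 0"
  shows "theta_char m 0 (- z) t = (- 1) ^ m * theta_char m 0 z t"
proof -
  have *: "theta_term m 0 n (- z) t = (- 1) ^ m * theta_term m 0 (- n) z t" for n
    unfolding theta_term_def by (simp flip: power_mult_distrib)
  have "theta_char m 0 (- z) t = (\<Sum>k. (- 1) ^ m * (theta_term m 0 (int k + 1) z t + theta_term m 0 (- int k) z t))"
    unfolding theta_char_def * by (simp add: distrib_left add_ac)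
  also have "\<dots> = (- 1) ^ m * theta_char m 0 z t"
    using sums_mult[OF suminf_int_shift[OF summable_theta_term[OF assms, of 0 m z]], of "(- 1) ^ m"]
    by (simp add: theta_char_eq_add[OF assms] sums_iff)
  finally show ?thesis .
qed

lemma theta_char_half_minus:
  assumes "Im t > 0"
  shows "theta_char m (1 / 2) (- z) t = (- 1) ^ m * theta_char m (1 / 2) z t"
proof -
  have *: "theta_term m (1 / 2) n (- z) t = (- 1) ^ m * theta_term m (1 / 2) (- n - 1) z t" for n
  proof -
    have 1: "of_int (- n - 1) + complex_of_real (1 / 2) = - (of_int n + complex_of_real (1 / 2))" by simp
    have 2: "(2 * of_real pi * \<i> * s) ^ m * exp (of_real pi * \<i> * (s\<^sup>2 * t + 2 * s * - z)) =
      (- 1) ^ m * ((2 * of_real pi * \<i> * - s) ^ m * exp (of_real pi * \<i> * ((- s)\<^sup>2 * t + 2 * - s * z)))" for s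
      by (simp flip: power_mult_distrib)
    show ?thesis unfolding theta_term_def 1 by (rule 2)
  qed
  have "theta_char m (1 / 2) (- z) t = (\<Sum>k. (- 1) ^ m * (theta_term m (1 / 2) (int k) z t + theta_term m (1 / 2) (- int k - 1) z t))"
    unfolding theta_char_def * by (simp add: distrib_left add_ac)
  also have "\<dots> = (- 1) ^ m * theta_char m (1 / 2) z t"
    unfolding theta_char_def
    using suminf_mult[OF summable_add[OF summable_theta_term[OF assms, of "1/2" m z]], of "(- 1) ^ m"] by simp
  finally show ?thesis .
qed

text \<open>\<open>dtheta\<^sub>i m\<close> is the \<open>m\<close>-th derivative of \<open>\<theta>\<^sub>i\<close> in \<open>z\<close>.\<close>

definition "dtheta1 m z t = theta_char m (1 / 2) (z - 1 / 2) t"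
definition "dtheta2 m z t = theta_char m (1 / 2) z t"
definition "dtheta3 m z t = theta_char m 0 z t"
definition "dtheta4 m z t = theta_char m 0 (z + 1 / 2) t"

lemmas dtheta_defs = dtheta1_def dtheta2_def dtheta3_def dtheta4_def

section \<open>Agreement with the defining trigonometric series\<close>

lemma theta2_eq:
  assumes "Im t > 0"
  shows "theta2 z t = dtheta2 0 z t"
proof -
  define e where "e k = exp (of_nat (k^2 + k) * of_real pi * \<i> * t) * cos ((2 * of_nat k + 1) * of_real pi * z)" for k
  define c where "c = 2 * exp (of_real pi * \<i> * t / 4)"
  have c0: "c \<noteq> 0" by (simp add: c_def)
  \<comment> \<open>The pair k, -k-1 has frequencies plus and minus (k + 1/2), and (k + 1/2)^2 = k^2
    + k + 1/4; the 1/4 is the prefactor in front of the series.\<close>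
  have *: "theta_term 0 (1 / 2) (int k) z t + theta_term 0 (1 / 2) (- int k - 1) z t = c * e k" for k
  proof -
    define x where "x = (2 * of_nat k + 1) * of_real pi * z"
    have 1: "theta_term 0 (1 / 2) (int k) z t = exp (of_real pi * \<i> * t / 4) * exp (of_nat (k^2 + k) * of_real pi * \<i> * t) * exp (\<i> * x)"
      unfolding theta_term_def x_def exp_add[symmetric] power_0 mult_1_left
      by (rule arg_cong[where f = exp]) (simp add: field_simps power2_eq_square)
    have 2: "theta_term 0 (1 / 2) (- int k - 1) z t = exp (of_real pi * \<i> * t / 4) * exp (of_nat (k^2 + k) * of_real pi * \<i> * t) * exp (- (\<i> * x))"
      unfolding theta_term_def x_def exp_add[symmetric] power_0 mult_1_left
      by (rule arg_cong[where f = exp]) (simp add: field_simps power2_eq_square)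
    show ?thesis unfolding 1 2 e_def c_def x_def[symmetric] cos_exp_eq by (simp add: algebra_simps)
  qed
  have "summable (\<lambda>k. c * e k)"
    unfolding *[symmetric] by (intro summable_add summable_theta_term assms) auto
  then have "summable e" using c0 by simp
  from suminf_mult[OF this, of c] show ?thesis
    by (simp only: theta2_def dtheta2_def theta_char_def * flip: e_def c_def)
qed

lemma theta3_eq:
  assumes "Im t > 0"
  shows "theta3 z t = dtheta3 0 z t"
proof -
  define u where "u n = theta_term 0 0 n z t" for n
  define e where "e k = exp (of_nat ((Suc k)^2) * of_real pi * \<i> * t) * cos (2 * of_nat (Suc k) * of_real pi * z)" for k
  have s: "summable (\<lambda>k. u (int k))" "summable (\<lambda>k. u (- int k - 1))"
    unfolding u_def by (intro summable_theta_term assms; simp)+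
  \<comment> \<open>With characteristic 0 the opposite frequencies are k+1 and -k-1, so the sum is
    re-paired and the term at 0 splits off as the constant 1.\<close>
  have *: "u (int (Suc k)) + u (- int k - 1) = 2 * e k" for k
  proof -
    define x where "x = 2 * of_nat (Suc k) * of_real pi * z"
    have 1: "u (int (Suc k)) = exp (of_nat ((Suc k)^2) * of_real pi * \<i> * t) * exp (\<i> * x)"
      unfolding theta_term_def x_def exp_add[symmetric] u_def power_0 mult_1_left
      by (rule arg_cong[where f = exp]) (simp add: field_simps power2_eq_square)
    have 2: "u (- int k - 1) = exp (of_nat ((Suc k)^2) * of_real pi * \<i> * t) * exp (- (\<i> * x))"
      unfolding theta_term_def x_def exp_add[symmetric] u_def power_0 mult_1_left
      by (rule arg_cong[where f = exp]) (simp add: field_simps power2_eq_square)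
    show ?thesis unfolding 1 2 e_def x_def[symmetric] cos_exp_eq by (simp add: algebra_simps)
  qed
  have s': "summable (\<lambda>k. u (int (Suc k)))" using s(1) by (subst summable_Suc_iff)
  have se: "summable (\<lambda>k. 2 * e k)" unfolding *[symmetric] by (intro summable_add s s')
  have "dtheta3 0 z t = (\<Sum>k. u (int k)) + (\<Sum>k. u (- int k - 1))"
    unfolding dtheta3_def u_def by (rule theta_char_eq_add) (use assms in auto)
  also have "\<dots> = u (int 0) + ((\<Sum>k. u (int (Suc k))) + (\<Sum>k. u (- int k - 1)))"
    using suminf_split_head[OF s(1)] by simp
  also have "\<dots> = 1 + (\<Sum>k. 2 * e k)"
    unfolding suminf_add[OF s' s(2)] * by (simp add: u_def theta_term_def)
  also have "\<dots> = 1 + 2 * (\<Sum>k. e k)" using se by (subst suminf_mult) auto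
  finally show ?thesis by (simp add: theta3_def e_def)
qed

lemma cos_complex_npi: "cos (of_nat n * of_real pi) = (- 1 :: complex) ^ n"
proof -
  have "cos (of_nat n * of_real pi) = complex_of_real (cos (real n * pi))"
    by (subst cos_of_real[symmetric]) simp
  then show ?thesis by simp
qed

lemma sin_complex_npi: "sin (of_nat n * of_real pi) = (0 :: complex)"
proof -
  have "sin (of_nat n * of_real pi) = complex_of_real (sin (real n * pi))"
    by (subst sin_of_real[symmetric]) simp
  then show ?thesis by simp
qed

lemma theta4_eq_theta3: "theta4 z t = theta3 (z + 1 / 2) t"
proof -
  have "cos (2 * of_nat (Suc k) * of_real pi * (z + 1 / 2)) = (- 1) ^ Suc k * cos (2 * of_nat (Suc k) * of_real pi * z)" for k
  proof -
    have "2 * of_nat (Suc k) * of_real pi * (z + 1 / 2) = 2 * of_nat (Suc k) * of_real pi * z + of_nat (Suc k) * of_real pi"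
      by (simp add: field_simps)
    then show ?thesis by (simp only: cos_add cos_complex_npi sin_complex_npi) simp
  qed
  then show ?thesis unfolding theta4_def theta3_def by (simp add: mult_ac)
qed

lemma theta1_eq_theta2: "theta1 z t = theta2 (z - 1 / 2) t"
proof -
  have "cos ((2 * of_nat k + 1) * of_real pi * (z - 1 / 2)) = (- 1) ^ k * sin ((2 * of_nat k + 1) * of_real pi * z)" for k
  proof -
    have "(2 * of_nat k + 1) * of_real pi * (z - 1 / 2) = ((2 * of_nat k + 1) * of_real pi * z - of_real pi / 2) - of_nat k * of_real pi"
      by (simp add: field_simps)
    moreover have "cos (y - complex_of_real pi / 2) = sin y" for y
      by (simp add: cos_diff sin_of_real[symmetric] cos_of_real[symmetric] flip: of_real_divide)
    ultimately show ?thesis by (simp only: cos_diff[of _ "of_nat k * of_real pi"] cos_complex_npi sin_complex_npi) simp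
  qed
  then show ?thesis unfolding theta1_def theta2_def by (simp add: mult_ac)
qed

lemma theta1_eq: "Im t > 0 \<Longrightarrow> theta1 z t = dtheta1 0 z t"
  by (simp add: theta1_eq_theta2 theta2_eq dtheta_defs)

lemma theta4_eq: "Im t > 0 \<Longrightarrow> theta4 z t = dtheta4 0 z t"
  by (simp add: theta4_eq_theta3 theta3_eq dtheta_defs)

section \<open>Division of quasi-periodic entire functions\<close>

definition period_lattice :: "complex \<Rightarrow> complex set" where
  "period_lattice t = {of_int m + of_int n * t | m n. True}"

text \<open>Here \<open>j\<close> is the degree: a product of \<open>j\<close> theta functions has
  this form, with \<open>c\<close> and \<open>d\<close> the products of their constant
  multipliers.\<close>

definition quasi_periodic :: "complex \<Rightarrow> nat \<Rightarrow> complex \<Rightarrow> complex \<Rightarrow> (complex \<Rightarrow> complex) \<Rightarrow> bool" where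
  "quasi_periodic t j c d f \<longleftrightarrow> f holomorphic_on UNIV \<and> (\<forall>z. f (z + 1) = c * f z) \<and>
     (\<forall>z. f (z + t) = d * theta_mult t z ^ j * f z)"

definition simple_zeros :: "complex \<Rightarrow> complex \<Rightarrow> (complex \<Rightarrow> complex) \<Rightarrow> bool" where
  "simple_zeros t a g \<longleftrightarrow> (\<forall>z. g z = 0 \<longleftrightarrow> z - a \<in> period_lattice t) \<and> (\<forall>z. g z = 0 \<longrightarrow> deriv g z \<noteq> 0)"

lemma theta_mult_nonzero [simp]: "theta_mult t z \<noteq> 0"
  by (simp add: theta_mult_def)

text \<open>The codomain is polymorphic so that the lemma also applies to the predicate
  \<open>f x = 0\<close>, which is truly periodic when \<open>f\<close> is only
  quasi-periodic.\<close>

lemma periodic_of_int_mult: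
  fixes f :: "complex \<Rightarrow> 'a"
  assumes "\<And>z. f (z + w) = f z"
  shows "f (z + of_int n * w) = f z"
proof (induction n arbitrary: z rule: int_induct[where k = 0])
  case (step1 i)
  show ?case using assms[of "z + of_int i * w"] step1(2)[of z] by (simp add: algebra_simps)
next
  case (step2 i)
  show ?case using assms[of "z + of_int (i - 1) * w"] step2(2)[of z] by (simp add: algebra_simps)
qed simp

lemma quasi_periodic_zero_lattice:
  assumes "quasi_periodic t j c d f" "c \<noteq> 0" "d \<noteq> 0" "f a = 0" "z - a \<in> period_lattice t"
  shows "f z = 0"
proof -
  obtain m n where "z - a = of_int m + of_int n * t" using assms(5) by (auto simp: period_lattice_def)
  then have z: "z = (a + of_int m * 1) + of_int n * t" by (simp add: algebra_simps)
  have "(f (x + 1) = 0) = (f x = 0)" "(f (x + t) = 0) = (f x = 0)" for x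
    using assms(1-3) by (auto simp: quasi_periodic_def)
  then show ?thesis unfolding z
    using periodic_of_int_mult[of "\<lambda>x. f x = 0" t] periodic_of_int_mult[of "\<lambda>x. f x = 0" 1 a m] assms(4) by metis
qed

text \<open>At a zero of \<open>g\<close> the quotient is given its l'Hopital value. Near such a
  point it agrees with the quotient of the difference quotients of \<open>f\<close> and
  \<open>g\<close>, which are holomorphic there, the lower one being nonzero because the zero is
  simple.\<close>

lemma entire_quotient_simple_zeros:
  assumes f: "f holomorphic_on UNIV" and g: "g holomorphic_on UNIV"
    and zero: "\<And>z. g z = 0 \<Longrightarrow> f z = 0" and simple: "\<And>z. g z = 0 \<Longrightarrow> deriv g z \<noteq> 0"
  obtains k where "k holomorphic_on UNIV" "\<And>z. f z = g z * k z"
proof -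
  define k where "k z = (if g z = 0 then deriv f z / deriv g z else f z / g z)" for z
  have "k field_differentiable at a" for a
  proof (cases "g a = 0")
    case False
    have "open {z. g z \<noteq> 0}" using holomorphic_on_imp_continuous_on[OF g] by (intro open_Collect_neq) auto
    moreover have "(\<lambda>z. f z / g z) field_differentiable at a"
      using False f g by (intro field_differentiable_divide) (auto simp: holomorphic_on_def)
    then obtain D where "((\<lambda>z. f z / g z) has_field_derivative D) (at a)" by (auto simp: field_differentiable_def)
    ultimately have "(k has_field_derivative D) (at a)"
      using False by (elim has_field_derivative_transform_within_open) (auto simp: k_def)
    then show ?thesis by (auto simp: field_differentiable_def)
  next
    case True
    define f1 where "f1 z = (if z = a then deriv f a else (f z - f a) / (z - a))" for z
    define g1 where "g1 z = (if z = a then deriv g a else (g z - g a) / (z - a))" for z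
    have h: "f1 holomorphic_on UNIV" "g1 holomorphic_on UNIV"
      unfolding f1_def g1_def using f g by (auto intro: pole_lemma_open)
    have "open {z. g1 z \<noteq> 0}" using holomorphic_on_imp_continuous_on[OF h(2)] by (intro open_Collect_neq) auto
    moreover have a: "g1 a \<noteq> 0" using simple[OF True] by (simp add: g1_def)
    moreover have "(\<lambda>z. f1 z / g1 z) field_differentiable at a"
      using a h by (intro field_differentiable_divide) (auto simp: holomorphic_on_def)
    then obtain D where "((\<lambda>z. f1 z / g1 z) has_field_derivative D) (at a)" by (auto simp: field_differentiable_def)
    moreover have "f1 z / g1 z = k z" if "g1 z \<noteq> 0" for z
      using that True zero[OF True] by (auto simp: k_def f1_def g1_def split: if_splits)
    ultimately have "(k has_field_derivative D) (at a)"
      by (elim has_field_derivative_transform_within_open) auto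
    then show ?thesis by (auto simp: field_differentiable_def)
  qed
  then have "k holomorphic_on UNIV" by (simp add: holomorphic_on_def)
  moreover have "f z = g z * k z" for z using zero[of z] by (simp add: k_def)
  ultimately show ?thesis using that by blast
qed

text \<open>Cancels \<open>g\<close> even at its own zeros: there the derivative of the vanishing
  product is \<open>deriv g z * h z\<close>.\<close>

lemma mult_eq_0_simple_zeros:
  assumes g: "g holomorphic_on UNIV" and h: "h holomorphic_on UNIV" and 0: "\<And>z. g z * h z = 0"
    and simple: "\<And>z. g z = 0 \<Longrightarrow> deriv g z \<noteq> 0"
  shows "h z = 0"
proof (cases "g z = 0")
  case True
  have "((\<lambda>z. g z * h z) has_field_derivative (deriv g z * h z + deriv h z * g z)) (at z)"
    by (intro DERIV_mult holomorphic_derivI[OF g] holomorphic_derivI[OF h]) auto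
  moreover have "((\<lambda>z. g z * h z) has_field_derivative 0) (at z)" unfolding 0 by simp
  ultimately have "deriv g z * h z + deriv h z * g z = 0" by (rule DERIV_unique)
  then show ?thesis using True simple by simp
qed (use 0[of z] in auto)

text \<open>One common zero suffices: quasi-periodicity spreads it over the coset of the lattice on
  which \<open>g\<close> vanishes. The shift laws of the quotient hold after multiplication by
  \<open>g\<close>, which is then cancelled; the degree drops by one.\<close>

lemma quasi_periodic_divide:
  assumes f: "quasi_periodic t (Suc j) cf df f" "cf \<noteq> 0" "df \<noteq> 0" "f a = 0"
    and g: "quasi_periodic t 1 cg dg g" "cg \<noteq> 0" "dg \<noteq> 0" "simple_zeros t a g"
  obtains k where "quasi_periodic t j (cf / cg) (df / dg) k" "\<And>z. f z = g z * k z"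
proof -
  have hf: "f holomorphic_on UNIV" and hg: "g holomorphic_on UNIV"
    using f g by (auto simp: quasi_periodic_def)
  have s: "deriv g z \<noteq> 0" if "g z = 0" for z using g(4) that by (auto simp: simple_zeros_def)
  have zero: "f z = 0" if "g z = 0" for z
    using quasi_periodic_zero_lattice[OF f, of z] g(4) that by (auto simp: simple_zeros_def)
  obtain k where k: "k holomorphic_on UNIV" and e: "\<And>z. f z = g z * k z"
    using entire_quotient_simple_zeros[OF hf hg zero s] by metis
  have shift: "(\<lambda>z. k (z + w)) holomorphic_on UNIV" for w
    using holomorphic_on_compose_gen[of "\<lambda>z. z + w" UNIV k UNIV, unfolded o_def] k
    by (simp add: holomorphic_on_add holomorphic_on_ident)
  have "k (z + 1) - cf / cg * k z = 0" for z
  proof (rule mult_eq_0_simple_zeros[OF hg, of "\<lambda>z. k (z + 1) - cf / cg * k z"])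
    show "(\<lambda>z. k (z + 1) - cf / cg * k z) holomorphic_on UNIV" by (intro holomorphic_intros shift k)
    fix z
    have "g (z + 1) * k (z + 1) = cf * (g z * k z)" using f(1) by (simp add: quasi_periodic_def e)
    moreover have "g (z + 1) = cg * g z" using g(1) by (simp add: quasi_periodic_def)
    ultimately show "g z * (k (z + 1) - cf / cg * k z) = 0" using g(2) by (simp add: field_simps)
  qed (use s in auto)
  moreover have "k (z + t) - df / dg * theta_mult t z ^ j * k z = 0" for z
  proof (rule mult_eq_0_simple_zeros[OF hg, of "\<lambda>z. k (z + t) - df / dg * theta_mult t z ^ j * k z"])
    show "(\<lambda>z. k (z + t) - df / dg * theta_mult t z ^ j * k z) holomorphic_on UNIV"
      unfolding theta_mult_def by (intro holomorphic_intros shift k)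
    fix z
    have "g (z + t) * k (z + t) = df * theta_mult t z ^ Suc j * (g z * k z)" using f(1) by (simp add: quasi_periodic_def e)
    moreover have "g (z + t) = dg * theta_mult t z * g z" using g(1) by (simp add: quasi_periodic_def)
    ultimately have "theta_mult t z * (dg * g z * k (z + t)) = theta_mult t z * (df * theta_mult t z ^ j * (g z * k z))"
      by (simp add: mult_ac)
    then have "dg * g z * k (z + t) = df * theta_mult t z ^ j * (g z * k z)" by simp
    then show "g z * (k (z + t) - df / dg * theta_mult t z ^ j * k z) = 0" using g(3) by (simp add: field_simps)
  qed (use s in auto)
  ultimately have "quasi_periodic t j (cf / cg) (df / dg) k" using k by (simp add: quasi_periodic_def)
  with e show ?thesis using that by blast
qed

lemma doubly_periodic_constant:
  assumes t: "Im t > 0" and k: "quasi_periodic t 0 1 1 k"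
  obtains c where "\<And>z. k z = c"
proof -
  have h: "k holomorphic_on UNIV" and p: "\<And>z. k (z + 1) = k z" "\<And>z. k (z + t) = k z"
    using k by (auto simp: quasi_periodic_def)
  have "k z \<in> k ` cball 0 (1 + Im t)" for z
  proof -
    \<comment> \<open>Translating by multiples of \<open>t\<close> first and by integers afterwards
      brings the point into the rectangle [0,1] x [0, Im t], hence into a fixed closed disc.\<close>
    define n where "n = \<lfloor>Im z / Im t\<rfloor>"
    define w where "w = z + of_int (- n) * t"
    define v where "v = w + of_int (- \<lfloor>Re w\<rfloor>) * 1"
    have "k v = k z"
      unfolding v_def w_def by (simp only: periodic_of_int_mult[of k 1, OF p(1)] periodic_of_int_mult[of k t, OF p(2)])
    moreover have "0 \<le> Im v" "Im v \<le> Im t"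
    proof -
      have "of_int n \<le> Im z / Im t" "Im z / Im t \<le> of_int n + 1" unfolding n_def by linarith+
      then show "0 \<le> Im v" "Im v \<le> Im t" using t by (auto simp: v_def w_def field_simps)
    qed
    moreover have "0 \<le> Re v" "Re v \<le> 1" 
      unfolding v_def using floor_correct[of "Re w"] by (simp_all only: plus_complex.sel mult_1_right of_int_minus uminus_complex.sel complex_Re_of_int) linarith+
    ultimately have "cmod v \<le> 1 + Im t" using cmod_le[of v] by simp
    with \<open>k v = k z\<close> show ?thesis by (intro image_eqI[of _ _ v]) auto
  qed
  then have "range k \<subseteq> k ` cball 0 (1 + Im t)" by blast
  moreover have "compact (k ` cball 0 (1 + Im t))"
    using holomorphic_on_imp_continuous_on[OF h] by (intro compact_continuous_image) (auto intro: continuous_on_subset)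
  ultimately have "bounded (range k)" using bounded_subset compact_imp_bounded by blast
  then have "k constant_on UNIV" using Liouville_theorem[OF h] by blast
  then show ?thesis using that by (auto simp: constant_on_def)
qed

section \<open>A product with the zeros of \<open>\<theta>\<^sub>1\<close>\<close>

text \<open>
  Euler's expansion of \<open>(w; q)\<^sub>\<infinity> = \<Prod>n. (1 - w q ^ n)\<close>. The functional equation
  \<open>qpoch q w = (1 - w) * qpoch q (q * w)\<close> replaces the product throughout.
\<close>

definition qpoch_coeff :: "complex \<Rightarrow> nat \<Rightarrow> complex" where
  "qpoch_coeff q n = (\<Prod>j<n. - (q ^ j) / (1 - q ^ Suc j))"

definition qpoch :: "complex \<Rightarrow> complex \<Rightarrow> complex" where
  "qpoch q w = (\<Sum>n. qpoch_coeff q n * w ^ n)"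

lemma power_Suc_neq_1:
  assumes "cmod q < 1"
  shows "q ^ Suc n \<noteq> 1"
proof
  assume "q ^ Suc n = 1"
  then have "cmod q ^ Suc n = 1" by (metis norm_power norm_one)
  moreover have "cmod q ^ Suc n < 1" using assms by (intro power_less_one_iff[THEN iffD2]) auto
  ultimately show False by simp
qed

lemma summable_qpoch:
  assumes q: "cmod q < 1"
  shows "summable (\<lambda>n. qpoch_coeff q n * w ^ n)"
proof -
  have "(\<lambda>n. cmod q ^ n * cmod w) \<longlonglongrightarrow> 0 * cmod w"
    using q by (intro tendsto_intros LIMSEQ_power_zero) auto
  \<comment> \<open>Successive terms have ratio |q|^n |w| / |1 - q^(n+1)|, whose denominator is at
    least 1 - |q|; this threshold makes the ratio at most 1/2.\<close>
  then have "\<forall>\<^sub>F n in sequentially. cmod q ^ n * cmod w < (1 - cmod q) / 2"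
    using q by (intro order_tendstoD) auto
  then obtain N where N: "\<And>n. n \<ge> N \<Longrightarrow> cmod q ^ n * cmod w < (1 - cmod q) / 2"
    by (auto simp: eventually_sequentially)
  show ?thesis
  proof (rule summable_ratio_test[where c = "1/2" and N = N])
    fix n assume n: "N \<le> n"
    have "cmod q ^ Suc n \<le> cmod q" using q power_decreasing[of 1 "Suc n" "cmod q"] by simp
    then have "1 - cmod q \<le> cmod (1 - q ^ Suc n)" using norm_triangle_ineq2[of 1 "q ^ Suc n"] by (simp add: norm_power norm_mult)
    then have "cmod q ^ n * cmod w / cmod (1 - q ^ Suc n) \<le> (1 - cmod q) / 2 / (1 - cmod q)"
      using N[OF n] q by (intro frac_le) auto
    also have "\<dots> = 1 / 2" using q by (simp add: field_simps)
    finally have "cmod q ^ n * cmod w / cmod (1 - q ^ Suc n) \<le> 1 / 2" .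
    moreover have "cmod (qpoch_coeff q (Suc n) * w ^ Suc n) =
       (cmod q ^ n * cmod w / cmod (1 - q ^ Suc n)) * cmod (qpoch_coeff q n * w ^ n)"
      by (simp add: qpoch_coeff_def norm_mult norm_divide norm_power)
    ultimately show "cmod (qpoch_coeff q (Suc n) * w ^ Suc n) \<le> 1 / 2 * cmod (qpoch_coeff q n * w ^ n)"
      by (simp only:) (rule mult_right_mono, auto)
  qed auto
qed

lemma qpoch_0 [simp]: "qpoch q 0 = 1"
proof -
  have "(\<Sum>n. qpoch_coeff q n * 0 ^ n) = qpoch_coeff q 0" by (rule powser_zero)
  then show ?thesis by (simp add: qpoch_def qpoch_coeff_def)
qed

lemma holomorphic_qpoch:
  assumes "cmod q < 1"
  shows "qpoch q holomorphic_on A"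
proof -
  have "(qpoch q has_field_derivative (\<Sum>n. diffs (qpoch_coeff q) n * w ^ n)) (at w)" for w
    unfolding qpoch_def[abs_def] by (rule termdiffs_strong_converges_everywhere) (rule summable_qpoch[OF assms])
  then have "qpoch q holomorphic_on UNIV" by (auto simp: holomorphic_on_def field_differentiable_def)
  then show ?thesis by (rule holomorphic_on_subset) simp
qed

lemma has_field_derivative_qpoch:
  assumes "cmod q < 1"
  shows "(qpoch q has_field_derivative deriv (qpoch q) w) (at w)"
  using holomorphic_derivI[OF holomorphic_qpoch[OF assms, of UNIV]] by auto

text \<open>Comparison of coefficients:
  \<open>c (Suc n) * (1 - q ^ Suc n) = - (q ^ n) * c n\<close>, while the constant terms of the two
  series cancel.\<close>

lemma qpoch_rec:
  assumes q: "cmod q < 1"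
  shows "qpoch q w = (1 - w) * qpoch q (q * w)"
proof -
  define c where "c = qpoch_coeff q"
  have s: "(\<lambda>n. c n * w ^ n) sums qpoch q w" "(\<lambda>n. c n * (q * w) ^ n) sums qpoch q (q * w)"
    unfolding c_def qpoch_def by (rule summable_sums[OF summable_qpoch[OF q]])+
  have "(\<lambda>n. c n * w ^ n - c n * (q * w) ^ n) sums (qpoch q w - qpoch q (q * w))"
    by (intro sums_diff s)
  then have "(\<lambda>n. c (Suc n) * w ^ Suc n - c (Suc n) * (q * w) ^ Suc n) sums (qpoch q w - qpoch q (q * w))"
    by (subst sums_Suc_iff) simp
  moreover have "c (Suc n) * w ^ Suc n - c (Suc n) * (q * w) ^ Suc n = - w * (c n * (q * w) ^ n)" for n
  proof -
    have "c (Suc n) * (1 - q ^ Suc n) = - (q ^ n) * c n"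
      using power_Suc_neq_1[OF q, of n] by (simp add: c_def qpoch_coeff_def)
    then have "c (Suc n) * (1 - q ^ Suc n) * w ^ Suc n = - (q ^ n) * c n * w ^ Suc n" by simp
    then show ?thesis by (simp add: algebra_simps power_mult_distrib)
  qed
  ultimately have "(\<lambda>n. - w * (c n * (q * w) ^ n)) sums (qpoch q w - qpoch q (q * w))" by simp
  then have "qpoch q w - qpoch q (q * w) = - w * qpoch q (q * w)"
    using sums_mult[OF s(2), of "- w"] sums_unique2 by blast
  then show ?thesis by (simp add: algebra_simps)
qed

text \<open>If no factor 1 - q^k w vanishes, the functional equation carries a zero at
  \<open>w\<close> to all q^k w; these tend to 0, where the function is 1 and continuous.\<close>

lemma qpoch_eq_0_iff:
  assumes q: "cmod q < 1"
  shows "qpoch q w = 0 \<longleftrightarrow> (\<exists>k. q ^ k * w = 1)"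
proof
  assume "\<exists>k. q ^ k * w = 1"
  then obtain k where "q ^ k * w = 1" by blast
  then show "qpoch q w = 0"
  proof (induction k arbitrary: w)
    case 0
    then show ?case using qpoch_rec[OF q, of w] by simp
  next
    case (Suc k)
    then show ?case using qpoch_rec[OF q, of w] Suc.IH[of "q * w"] by (simp add: mult_ac)
  qed
next
  assume 0: "qpoch q w = 0"
  show "\<exists>k. q ^ k * w = 1"
  proof (rule ccontr)
    assume n: "\<nexists>k. q ^ k * w = 1"
    have z: "qpoch q (q ^ k * w) = 0" for k
    proof (induction k)
      case (Suc k)
      then show ?case using qpoch_rec[OF q, of "q ^ k * w"] n by (auto simp: mult_ac)
    qed (use 0 in simp)
    have "(\<lambda>k. q ^ k * w) \<longlonglongrightarrow> 0 * w" using q by (intro tendsto_intros LIMSEQ_power_zero)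
    then have "(\<lambda>k. qpoch q (q ^ k * w)) \<longlonglongrightarrow> qpoch q 0"
      using isCont_tendsto_compose[OF DERIV_isCont[OF has_field_derivative_qpoch[OF q, of 0]]] by simp
    then show False by (simp add: z LIMSEQ_const_iff)
  qed
qed

lemma deriv_qpoch_rec:
  assumes q: "cmod q < 1"
  shows "deriv (qpoch q) w = - qpoch q (q * w) + q * (1 - w) * deriv (qpoch q) (q * w)"
proof -
  have "((\<lambda>w. (1 - w) * qpoch q (q * w)) has_field_derivative
     (0 - 1) * qpoch q (q * w) + deriv (qpoch q) (q * w) * q * (1 - w)) (at w)"
    by (rule derivative_eq_intros DERIV_chain2[OF has_field_derivative_qpoch[OF q]] refl | simp)+
  moreover have "(\<lambda>w. (1 - w) * qpoch q (q * w)) = qpoch q"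
    by (rule ext) (rule qpoch_rec[OF q, symmetric])
  ultimately have "(qpoch q has_field_derivative
     (0 - 1) * qpoch q (q * w) + deriv (qpoch q) (q * w) * q * (1 - w)) (at w)"
    by (simp only:)
  from DERIV_imp_deriv[OF this] show ?thesis by (simp add: algebra_simps)
qed

text \<open>At w = 1 the derivative is \<open>- qpoch q q\<close>, which is nonzero; at any other
  zero the differentiated functional equation passes to q w with the nonzero factor q (1 -
  w).\<close>

lemma deriv_qpoch_nonzero:
  assumes q: "cmod q < 1" "q \<noteq> 0" and "qpoch q w = 0"
  shows "deriv (qpoch q) w \<noteq> 0"
proof -
  obtain k where "q ^ k * w = 1" using assms qpoch_eq_0_iff by blast
  then show ?thesis
  proof (induction k arbitrary: w)
    case 0
    have "qpoch q q \<noteq> 0" using power_Suc_neq_1[OF q(1)] by (auto simp: qpoch_eq_0_iff[OF q(1)] mult_ac)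
    then show ?case using 0 deriv_qpoch_rec[OF q(1), of w] by simp
  next
    case (Suc k)
    then have e: "q ^ k * (q * w) = 1" by (simp add: mult_ac)
    then have "qpoch q (q * w) = 0" using qpoch_eq_0_iff[OF q(1)] by blast
    moreover have "w \<noteq> 1" using Suc.prems power_Suc_neq_1[OF q(1), of k] by auto
    ultimately show ?case using Suc.IH[OF e] q deriv_qpoch_rec[OF q(1), of w] by simp
  qed
qed

section \<open>The triple product for theta_1, up to a factor constant in \<open>z\<close>\<close>

definition nome2 :: "complex \<Rightarrow> complex" where
  "nome2 z = exp (2 * of_real pi * \<i> * z)"

text \<open>With x = \<open>nome2 z\<close> and q = \<open>nome2 t\<close>, this is x^(-1/2) times
  the product of (1 - x q^n) (1 - q^(n+1)/x) over n >= 0. The half power gives it the multipliers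
  -1, -1 of theta_1.\<close>

definition theta_prod :: "complex \<Rightarrow> complex \<Rightarrow> complex" where
  "theta_prod t z = exp (- of_real pi * \<i> * z) * qpoch (nome2 t) (nome2 z) * qpoch (nome2 t) (nome2 (t - z))"

lemma nome2_nonzero [simp]: "nome2 z \<noteq> 0"
  by (simp add: nome2_def)

lemma nome2_add: "nome2 (x + y) = nome2 x * nome2 y"
  by (simp add: nome2_def distrib_left exp_add)

lemma nome2_power: "nome2 x ^ k = nome2 (of_nat k * x)"
  by (simp add: nome2_def exp_of_nat_mult[symmetric] mult_ac)

lemma norm_nome2_less_1: "Im t > 0 \<Longrightarrow> cmod (nome2 t) < 1"
  by (simp add: nome2_def)

lemma nome2_eq_1_iff: "nome2 x = 1 \<longleftrightarrow> (\<exists>n::int. x = of_int n)"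
proof -
  have "nome2 x = 1 \<longleftrightarrow> (\<exists>n::int. 2 * of_real pi * \<i> * x = of_int (2 * n) * of_real pi * \<i>)"
    using exp_eq[of "2 * of_real pi * \<i> * x" 0] by (simp add: nome2_def)
  also have "\<dots> \<longleftrightarrow> (\<exists>n::int. x = of_int n)" by (intro arg_cong[where f = Ex] ext) auto
  finally show ?thesis .
qed

lemma nome2_1 [simp]: "nome2 1 = 1"
  unfolding nome2_eq_1_iff by (rule exI[of _ 1]) simp

lemma has_field_derivative_nome2 [derivative_intros]:
  "(f has_field_derivative f') (at z) \<Longrightarrow> ((\<lambda>z. nome2 (f z)) has_field_derivative 2 * of_real pi * \<i> * f' * nome2 (f z)) (at z)"
  unfolding nome2_def by (auto intro!: derivative_eq_intros)

lemma holomorphic_nome2 [holomorphic_intros]: "f holomorphic_on A \<Longrightarrow> (\<lambda>z. nome2 (f z)) holomorphic_on A"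
  unfolding nome2_def by (intro holomorphic_intros)

lemma qpoch_nome2_eq_0_iff:
  assumes "Im t > 0"
  shows "qpoch (nome2 t) (nome2 z) = 0 \<longleftrightarrow> (\<exists>k m. z = of_int m - of_nat k * t)"
  unfolding qpoch_eq_0_iff[OF norm_nome2_less_1[OF assms]] nome2_power nome2_add[symmetric] nome2_eq_1_iff
  by (auto simp: algebra_simps eq_diff_eq)

lemma theta_prod_quasi_periodic:
  assumes t: "Im t > 0"
  shows "quasi_periodic t 1 (- 1) (- 1) (theta_prod t)"
proof -
  note q = norm_nome2_less_1[OF t]
  have comp: "(\<lambda>z. qpoch (nome2 t) (f z)) holomorphic_on UNIV" if "f holomorphic_on UNIV" for f
    using holomorphic_on_compose_gen[OF that holomorphic_qpoch[OF q, of UNIV]] by (simp add: o_def)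
  have "theta_prod t holomorphic_on UNIV"
    unfolding theta_prod_def[abs_def] by (intro holomorphic_intros comp)
  moreover have "theta_prod t (z + 1) = - 1 * theta_prod t z" for z
  proof -
    have "exp (- of_real pi * \<i> * (z + 1)) = - exp (- of_real pi * \<i> * z)"
      by (simp add: distrib_left exp_add exp_minus exp_diff)
    moreover have "nome2 (z + 1) = nome2 z" by (simp add: nome2_add)
    moreover have "nome2 (t - (z + 1)) = nome2 (t - z)" using nome2_add[of "t - (z + 1)" 1] by simp
    ultimately show ?thesis by (simp add: theta_prod_def)
  qed
  moreover have "theta_prod t (z + t) = - 1 * theta_mult t z ^ 1 * theta_prod t z" for z
  proof -
    define x where "x = exp (of_real pi * \<i> * z)"
    have x: "x \<noteq> 0" "nome2 z = x * x" "exp (- of_real pi * \<i> * z) = 1 / x"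
      by (auto simp: x_def nome2_def exp_add[symmetric] exp_minus field_simps)
    have m: "theta_mult t z = exp (- of_real pi * \<i> * t) / (x * x)"
      by (simp add: theta_mult_def x_def exp_add[symmetric] exp_diff[symmetric] algebra_simps)
    have e: "exp (- of_real pi * \<i> * (z + t)) = exp (- of_real pi * \<i> * t) / x"
      by (simp add: x_def exp_diff[symmetric] algebra_simps)
    \<comment> \<open>Translation by \<open>t\<close> removes the factor 1 - x^2 from the first
      product and adds 1 - 1/x^2 to the second; their quotient is -1/x^2.\<close>
    have 1: "qpoch (nome2 t) (nome2 z) = (1 - x * x) * qpoch (nome2 t) (nome2 (z + t))"
      using qpoch_rec[OF q, of "nome2 z"] by (simp add: nome2_add x mult_ac)
    have 2: "qpoch (nome2 t) (nome2 (t - (z + t))) = (1 - 1 / (x * x)) * qpoch (nome2 t) (nome2 (t - z))"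
    proof -
      have "nome2 (t - (z + t)) = 1 / (x * x)"
        using nome2_add[of "- z" z] x by (simp add: nome2_def field_simps)
      moreover have "nome2 t * nome2 (t - (z + t)) = nome2 (t - z)" by (simp add: nome2_add[symmetric])
      ultimately show ?thesis using qpoch_rec[OF q, of "nome2 (t - (z + t))"] by simp
    qed
    show ?thesis unfolding theta_prod_def e 1 2 m x(3) using x(1) by (simp add: field_simps)
  qed
  ultimately show ?thesis unfolding quasi_periodic_def by blast
qed

text \<open>The zeros m - k t of the first product and m + (k+1) t of the second, with k >= 0,
  partition the lattice. At each lattice point only one of the two products vanishes, and it does so
  simply.\<close>

lemma theta_prod_simple_zeros:
  assumes t: "Im t > 0"
  shows "simple_zeros t 0 (theta_prod t)"
proof -
  note q = norm_nome2_less_1[OF t]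
  have im0: "n = 0" if "of_int m + of_int n * t = 0" for m n
    using arg_cong[OF that, of Im] t by simp
  let ?A = "\<lambda>z. qpoch (nome2 t) (nome2 z)" and ?B = "\<lambda>z. qpoch (nome2 t) (nome2 (t - z))"
  let ?E = "\<lambda>z. exp (- of_real pi * \<i> * z)"
  have zero: "theta_prod t z = 0 \<longleftrightarrow> z - 0 \<in> period_lattice t" for z
  proof
    assume "theta_prod t z = 0"
    then consider k m where "z = of_int m - of_nat k * t" | k m where "t - z = of_int m - of_nat k * t"
      by (auto simp: theta_prod_def qpoch_nome2_eq_0_iff[OF t])
    then show "z - 0 \<in> period_lattice t"
    proof cases
      case (1 k m)
      then show ?thesis unfolding period_lattice_def by (intro CollectI exI[of _ m] exI[of _ "- int k"]) simp
    next
      case (2 k m)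
      then show ?thesis unfolding period_lattice_def
        by (intro CollectI exI[of _ "- m"] exI[of _ "int k + 1"]) (simp add: algebra_simps)
    qed
  next
    assume "z - 0 \<in> period_lattice t"
    then obtain m n where z: "z = of_int m + of_int n * t" by (auto simp: period_lattice_def)
    show "theta_prod t z = 0"
    proof (cases "n \<le> 0")
      case True
      then have "z = of_int m - of_nat (nat (- n)) * t" by (simp add: z)
      then show ?thesis unfolding theta_prod_def using qpoch_nome2_eq_0_iff[OF t, of z] by auto
    next
      case False
      then have "t - z = of_int (- m) - of_nat (nat (n - 1)) * t" by (simp add: z algebra_simps)
      then have "?B z = 0" using qpoch_nome2_eq_0_iff[OF t, of "t - z"] by blast
      then show ?thesis by (simp add: theta_prod_def)
    qed
  qed
  have "deriv (theta_prod t) z \<noteq> 0" if z: "theta_prod t z = 0" for z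
  proof -
    let ?A' = "deriv (qpoch (nome2 t)) (nome2 z)" and ?B' = "deriv (qpoch (nome2 t)) (nome2 (t - z))"
    define a b c where "a = ?A' * (2 * of_real pi * \<i> * nome2 z)" and "b = ?B' * (- 2 * of_real pi * \<i> * nome2 (t - z))"
      and "c = - of_real pi * \<i> * ?E z"
    have dA: "(?A has_field_derivative a) (at z)"
      unfolding a_def by (rule DERIV_chain2[OF has_field_derivative_qpoch[OF q]]) (auto intro!: derivative_eq_intros)
    have dB: "(?B has_field_derivative b) (at z)"
      unfolding b_def by (rule DERIV_chain2[OF has_field_derivative_qpoch[OF q]]) (auto intro!: derivative_eq_intros)
    have dE: "(?E has_field_derivative c) (at z)"
      unfolding c_def by (auto intro!: derivative_eq_intros)
    have "deriv (theta_prod t) z = (c * ?A z + a * ?E z) * ?B z + b * (?E z * ?A z)"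
      unfolding theta_prod_def[abs_def] by (intro DERIV_imp_deriv DERIV_mult dA dB dE)
    moreover have "\<not> (?A z = 0 \<and> ?B z = 0)"
    proof
      assume "?A z = 0 \<and> ?B z = 0"
      then obtain k m k' m' where "z = of_int m - of_nat k * t" "t - z = of_int m' - of_nat k' * t"
        unfolding qpoch_nome2_eq_0_iff[OF t] by blast
      then have "of_int (m + m') + of_int (- int k - int k' - 1) * t = 0" by (simp add: algebra_simps)
      from im0[OF this] show False by simp
    qed
    moreover have "?A z = 0 \<or> ?B z = 0" using z by (simp add: theta_prod_def)
    moreover have "?A z = 0 \<Longrightarrow> a \<noteq> 0" "?B z = 0 \<Longrightarrow> b \<noteq> 0"
      using deriv_qpoch_nonzero[OF q nome2_nonzero] by (auto simp: a_def b_def)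
    ultimately show ?thesis by auto
  qed
  with zero show ?thesis unfolding simple_zeros_def by blast
qed

section \<open>Zeros and quasi-periods of the four theta functions\<close>

lemma dtheta1_dz: "Im t > 0 \<Longrightarrow> ((\<lambda>z. dtheta1 m z t) has_field_derivative dtheta1 (Suc m) z t) (at z)"
  unfolding dtheta1_def
  using theta_char_dz[of t "1/2" m "z + - (1/2)"] DERIV_shift[of "\<lambda>z. theta_char m (1/2) z t" _ z "- (1/2)"] by simp

lemma dtheta2_dz: "Im t > 0 \<Longrightarrow> ((\<lambda>z. dtheta2 m z t) has_field_derivative dtheta2 (Suc m) z t) (at z)"
  unfolding dtheta2_def by (rule theta_char_dz) auto

lemma dtheta3_dz: "Im t > 0 \<Longrightarrow> ((\<lambda>z. dtheta3 m z t) has_field_derivative dtheta3 (Suc m) z t) (at z)"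
  unfolding dtheta3_def by (rule theta_char_dz) auto

lemma dtheta4_dz: "Im t > 0 \<Longrightarrow> ((\<lambda>z. dtheta4 m z t) has_field_derivative dtheta4 (Suc m) z t) (at z)"
  unfolding dtheta4_def
  using theta_char_dz[of t 0 m "z + 1/2"] DERIV_shift[of "\<lambda>z. theta_char m 0 z t" _ z "1/2"] by simp

lemmas dtheta_dz = dtheta1_dz dtheta2_dz dtheta3_dz dtheta4_dz

lemma dtheta_heat:
  assumes "Im t > 0"
  shows "((\<lambda>t. dtheta1 m z t) has_field_derivative dtheta1 (Suc (Suc m)) z t / (4 * of_real pi * \<i>)) (at t)"
    "((\<lambda>t. dtheta2 m z t) has_field_derivative dtheta2 (Suc (Suc m)) z t / (4 * of_real pi * \<i>)) (at t)"
    "((\<lambda>t. dtheta3 m z t) has_field_derivative dtheta3 (Suc (Suc m)) z t / (4 * of_real pi * \<i>)) (at t)"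
    "((\<lambda>t. dtheta4 m z t) has_field_derivative dtheta4 (Suc (Suc m)) z t / (4 * of_real pi * \<i>)) (at t)"
  unfolding dtheta_defs by (intro theta_char_dt assms; simp)+

lemma dtheta_half_shift:
  assumes "Im t > 0"
  shows "dtheta1 m (z + 1 / 2) t = dtheta2 m z t" "dtheta2 m (z + 1 / 2) t = - dtheta1 m z t"
    "dtheta3 m (z + 1 / 2) t = dtheta4 m z t" "dtheta4 m (z + 1 / 2) t = dtheta3 m z t"
proof -
  have "z + 1 / 2 = z - 1 / 2 + 1" "z + 1 / 2 + 1 / 2 = z + 1" by auto
  then show "dtheta1 m (z + 1 / 2) t = dtheta2 m z t" "dtheta2 m (z + 1 / 2) t = - dtheta1 m z t"
    "dtheta3 m (z + 1 / 2) t = dtheta4 m z t" "dtheta4 m (z + 1 / 2) t = dtheta3 m z t"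
    using theta_char_1_shift[of "1/2" "-1" t m "z - 1/2"] theta_char_1_shift[of 0 1 t m z] assms
    by (auto simp only: dtheta_defs) auto
qed

lemma dtheta_minus:
  assumes "Im t > 0"
  shows "dtheta1 m (- z) t = (- 1) ^ Suc m * dtheta1 m z t" "dtheta2 m (- z) t = (- 1) ^ m * dtheta2 m z t"
    "dtheta3 m (- z) t = (- 1) ^ m * dtheta3 m z t" "dtheta4 m (- z) t = (- 1) ^ m * dtheta4 m z t"
proof -
  have p: "theta_char m (1 / 2) (z + 1) t = - theta_char m (1 / 2) z t" "theta_char m 0 (z + 1) t = theta_char m 0 z t" for z
    using theta_char_1_shift[of "1/2" "-1" t m z] theta_char_1_shift[of 0 1 t m z] assms by auto
  have "dtheta1 m (- z) t = theta_char m (1 / 2) (- (z + 1 / 2)) t" by (simp add: dtheta1_def)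
  also have "\<dots> = (- 1) ^ m * theta_char m (1 / 2) ((z - 1 / 2) + 1) t"
    unfolding theta_char_half_minus[OF assms] by (simp add: field_simps)
  also have "\<dots> = (- 1) ^ Suc m * dtheta1 m z t" unfolding p by (simp add: dtheta1_def)
  finally show "dtheta1 m (- z) t = (- 1) ^ Suc m * dtheta1 m z t" .
  have "dtheta4 m (- z) t = theta_char m 0 ((- (z + 1 / 2)) + 1) t" by (simp add: dtheta4_def)
  also have "\<dots> = (- 1) ^ m * dtheta4 m z t"
    unfolding p theta_char_0_minus[OF assms] by (simp add: dtheta4_def)
  finally show "dtheta4 m (- z) t = (- 1) ^ m * dtheta4 m z t" .
qed (auto simp: dtheta_defs theta_char_half_minus[OF assms] theta_char_0_minus[OF assms])

lemma dtheta1_0_even: "Im t > 0 \<Longrightarrow> even m \<Longrightarrow> dtheta1 m 0 t = 0"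
  using dtheta_minus(1)[of t m 0] by (simp add: eq_neg_iff_add_eq_0)

lemma dtheta_0_odd:
  assumes "Im t > 0" "odd m"
  shows "dtheta2 m 0 t = 0" "dtheta3 m 0 t = 0" "dtheta4 m 0 t = 0"
  using dtheta_minus[of t m 0] assms by (auto simp: eq_neg_iff_add_eq_0)

lemma theta_mult_add_half: "theta_mult t (z + 1 / 2) = - theta_mult t z" "theta_mult t (z - 1 / 2) = - theta_mult t z"
  by (auto simp: theta_mult_def ring_distribs exp_diff exp_add exp_minus)

lemma holomorphic_on_if_has_field_derivative:
  assumes "\<And>z. (f has_field_derivative f' z) (at z)"
  shows "f holomorphic_on A"
  using assms by (auto simp: holomorphic_on_def field_differentiable_def intro: has_field_derivative_at_within)

lemma holomorphic_dtheta:
  assumes "Im t > 0"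
  shows "(\<lambda>z. dtheta1 m z t) holomorphic_on A" "(\<lambda>z. dtheta2 m z t) holomorphic_on A"
    "(\<lambda>z. dtheta3 m z t) holomorphic_on A" "(\<lambda>z. dtheta4 m z t) holomorphic_on A"
  by (rule holomorphic_on_if_has_field_derivative, rule dtheta_dz[OF assms])+

lemma dtheta_quasi_periodic:
  assumes t: "Im t > 0"
  shows "quasi_periodic t 1 (- 1) (- 1) (\<lambda>z. dtheta1 0 z t)" "quasi_periodic t 1 (- 1) 1 (\<lambda>z. dtheta2 0 z t)"
    "quasi_periodic t 1 1 1 (\<lambda>z. dtheta3 0 z t)" "quasi_periodic t 1 1 (- 1) (\<lambda>z. dtheta4 0 z t)"
proof -
  have p: "theta_char 0 (1 / 2) (z + 1) t = - theta_char 0 (1 / 2) z t" "theta_char 0 0 (z + 1) t = theta_char 0 0 z t" for z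
    using theta_char_1_shift[of "1/2" "-1" t 0 z] theta_char_1_shift[of 0 1 t 0 z] assms by auto
  have s: "theta_char 0 (1 / 2) (z + t) t = theta_mult t z * theta_char 0 (1 / 2) z t"
    "theta_char 0 0 (z + t) t = theta_mult t z * theta_char 0 0 z t" for z
    using theta_char_tau_shift[OF t] by auto
  note h = holomorphic_dtheta[OF t, of 0 UNIV]
  show "quasi_periodic t 1 (- 1) (- 1) (\<lambda>z. dtheta1 0 z t)"
    using h(1) p(1)[of "z - 1/2" for z] s(1)[of "z - 1/2" for z] unfolding quasi_periodic_def dtheta1_def
    by (simp add: algebra_simps theta_mult_add_half)
  show "quasi_periodic t 1 1 (- 1) (\<lambda>z. dtheta4 0 z t)"
    using h(4) p(2)[of "z + 1/2" for z] s(2)[of "z + 1/2" for z] unfolding quasi_periodic_def dtheta4_def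
    by (simp add: algebra_simps theta_mult_add_half)
qed (use holomorphic_dtheta[OF t, of 0 UNIV] theta_char_1_shift[of "1/2" "-1" t 0] theta_char_1_shift[of 0 1 t 0] theta_char_tau_shift[OF t] t
     in \<open>auto simp: quasi_periodic_def dtheta_defs\<close>)

text \<open>Completing the square absorbs the characteristic 1/2 into a half-period translation: (n
  + 1/2)^2 t + 2 (n + 1/2) z = n^2 t + 2 n (z + t/2) + t/4 + z.\<close>

lemma dtheta2_eq_dtheta3:
  assumes "Im t > 0"
  shows "dtheta2 0 z t = exp (of_real pi * \<i> * (t / 4 + z)) * dtheta3 0 (z + t / 2) t"
proof -
  have "theta_term 0 (1 / 2) n z t = exp (of_real pi * \<i> * (t / 4 + z)) * theta_term 0 0 n (z + t / 2) t" for n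
    unfolding theta_term_def power_0 mult_1_left exp_add[symmetric]
    by (rule arg_cong[where f = exp]) (simp add: field_simps power2_eq_square)
  then show ?thesis
    unfolding dtheta_defs theta_char_def
    using suminf_mult[OF summable_add[OF summable_theta_term[of t 0 0 "z + t / 2"]]] assms by (simp flip: distrib_left)
qed

text \<open>Integrating the series over a period isolates its constant term \<open>1\<close>.\<close>

lemma dtheta3_not_identically_0:
  assumes t: "Im t > 0"
  obtains z where "dtheta3 0 z t \<noteq> 0"
proof (rule ccontr)
  assume "\<not> thesis"
  then have 0: "dtheta3 0 z t = 0" for z using that by blast
  \<comment> \<open>A termwise primitive in \<open>z\<close>. The term of index 0 is the constant 1
    with primitive \<open>z\<close>; it sits in the first half, as -k-1 is never 0.\<close>
  define g where "g k z = (if k = 0 then z else theta_term 0 0 (int k) z t / (2 * of_real pi * \<i> * of_nat k)) -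
    theta_term 0 0 (- int k - 1) z t / (2 * of_real pi * \<i> * (of_nat k + 1))" for k z
  have dg: "(g k has_field_derivative theta_term 0 0 (int k) z t + theta_term 0 0 (- int k - 1) z t) (at z)" for k z
  proof -
    have 1: "((\<lambda>z. theta_term 0 0 (- int k - 1) z t / (2 * of_real pi * \<i> * (of_nat k + 1))) has_field_derivative
       - theta_term 0 0 (- int k - 1) z t) (at z)"
    proof (rule DERIV_cong[OF DERIV_cdivide[OF theta_term_dz]])
      have "of_nat k + 1 \<noteq> (0 :: complex)" by (metis of_nat_Suc of_nat_eq_0_iff nat.distinct(1) add.commute)
      moreover have "theta_term (Suc 0) 0 (- int k - 1) z t = - (2 * of_real pi * \<i> * (of_nat k + 1)) * theta_term 0 0 (- int k - 1) z t"
        by (simp add: theta_term_def algebra_simps)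
      ultimately show "theta_term (Suc 0) 0 (- int k - 1) z t / (2 * of_real pi * \<i> * (of_nat k + 1)) = - theta_term 0 0 (- int k - 1) z t"
        by (simp add: divide_simps)
    qed
    have 2: "((\<lambda>z. if k = 0 then z else theta_term 0 0 (int k) z t / (2 * of_real pi * \<i> * of_nat k)) has_field_derivative
       theta_term 0 0 (int k) z t) (at z)"
    proof (cases "k = 0")
      case False
      have "theta_term (Suc 0) 0 (int k) z t = (2 * of_real pi * \<i> * of_nat k) * theta_term 0 0 (int k) z t"
        by (simp add: theta_term_def)
      then have "((\<lambda>z. theta_term 0 0 (int k) z t / (2 * of_real pi * \<i> * of_nat k)) has_field_derivative
         theta_term 0 0 (int k) z t) (at z)"
        using False by (intro DERIV_cong[OF DERIV_cdivide[OF theta_term_dz]]) simp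
      then show ?thesis using False by simp
    qed (simp add: theta_term_def)
    show ?thesis using DERIV_diff[OF 2 1] by (simp add: g_def[abs_def])
  qed
  have div: "cmod (x / (2 * of_real pi * \<i> * y)) \<le> cmod x" if "1 \<le> cmod y" for x y
  proof -
    have "1 \<le> 2 * pi * cmod y" using that pi_ge_two mult_mono[of 1 "2 * pi" 1 "cmod y"] by simp
    then have "cmod x / (2 * pi * cmod y) \<le> cmod x / 1" by (intro divide_left_mono) auto
    then show ?thesis by (simp add: norm_divide norm_mult)
  qed
  have bound: "cmod (g k z) \<le> (if k = 0 then R else 0) + 2 * theta_bound 0 R (Im t) k" if z: "cmod z \<le> R" for k z R
  proof -
    have b: "cmod (theta_term 0 0 (int k) z t) \<le> theta_bound 0 R (Im t) k" "cmod (theta_term 0 0 (- int k - 1) z t) \<le> theta_bound 0 R (Im t) k"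
      using z t by (auto intro!: norm_theta_term_nonneg_le norm_theta_term_neg_le)
    have "cmod (of_nat k + 1) = real k + 1" using norm_of_nat[of "Suc k", where ?'a = complex] by (simp add: add.commute)
    then have 1: "cmod (theta_term 0 0 (- int k - 1) z t / (2 * of_real pi * \<i> * (of_nat k + 1))) \<le> theta_bound 0 R (Im t) k"
      by (intro order_trans[OF div b(2)]) simp
    have 2: "cmod (if k = 0 then z else theta_term 0 0 (int k) z t / (2 * of_real pi * \<i> * of_nat k))
       \<le> (if k = 0 then R else 0) + theta_bound 0 R (Im t) k"
      using z theta_bound_nonneg[of 0 R "Im t" k] order_trans[OF div b(1), of "of_nat k"] by auto
    show ?thesis unfolding g_def using order_trans[OF norm_triangle_ineq4 add_mono[OF 2 1]] by simp
  qed
  have sb: "summable (\<lambda>k. (if k = 0 then R else 0) + 2 * theta_bound 0 R (Im t) k)" for R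
    by (intro summable_add summable_mult summable_theta_bound) auto
  have sg: "summable (\<lambda>k. g k z)" for z
    by (rule summable_comparison_test'[OF sb[of "cmod z"], of 0]) (use bound in auto)
  have "((\<lambda>z. \<Sum>k. g k z) has_field_derivative dtheta3 0 z t) (at z)" for z
    unfolding dtheta3_def theta_char_def
  proof (rule has_field_derivative_suminf_dominated[of UNIV, OF open_UNIV UNIV_I dg])
    fix x :: complex
    have "cmod (g n y) \<le> (if n = 0 then cmod x + 1 else 0) + 2 * theta_bound 0 (cmod x + 1) (Im t) n" if "y \<in> ball x 1" for n y
      using that norm_triangle_ineq2[of y x] by (intro bound) (simp add: dist_norm norm_minus_commute)
    then show "\<exists>d h. 0 < d \<and> summable h \<and> (\<forall>n y. y \<in> ball x d \<inter> UNIV \<longrightarrow> cmod (g n y) \<le> h n)"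
      using sb[of "cmod x + 1"] by (intro exI[of _ 1] exI conjI) auto
  qed
  then have "((\<lambda>z. \<Sum>k. g k z) has_field_derivative 0) (at z within UNIV)" for z by (simp add: 0)
  from has_field_derivative_zero_constant[OF convex_UNIV this] obtain c where c: "(\<Sum>k. g k z) = c" for z by auto
  \<comment> \<open>Every summand of the primitive except \<open>z\<close> has period 1, so the
    primitive grows by exactly 1 from 0 to 1; a constant cannot.\<close>
  have "theta_term 0 0 n 1 t = theta_term 0 0 n 0 t" for n
    using exp_integer_2pi[of "of_int n"] by (simp add: theta_term_def distrib_left exp_add mult_ac)
  then have "(\<lambda>k. g k 1 - g k 0) = (\<lambda>k. if k = 0 then 1 else 0)" by (auto simp: g_def)
  moreover have "(\<Sum>k. g k 1 - g k 0) = 0" using suminf_diff[OF sg sg, of 1 0] c by simp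
  ultimately have "(\<Sum>k::nat. if k = 0 then 1 else 0) = (0 :: complex)" by simp
  then show False using suminf_finite[of "{0::nat}" "\<lambda>k. if k = 0 then 1 else (0::complex)"] by simp
qed

text \<open>Both sides have the same multipliers and theta_1 vanishes at 0, so the quotient is
  doubly periodic and entire. It is not 0: otherwise half-period translations would make theta_2 and
  then theta_3 vanish identically.\<close>

lemma dtheta1_eq_theta_prod:
  assumes t: "Im t > 0"
  obtains c where "c \<noteq> 0" "\<And>z. dtheta1 0 z t = c * theta_prod t z"
proof -
  obtain k where k: "quasi_periodic t 0 ((- 1) / (- 1)) ((- 1) / (- 1)) k" and e: "\<And>z. dtheta1 0 z t = theta_prod t z * k z"
  proof (rule quasi_periodic_divide)
    show "quasi_periodic t (Suc 0) (- 1) (- 1) (\<lambda>z. dtheta1 0 z t)"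
      using dtheta_quasi_periodic(1)[OF t] by simp
    show "dtheta1 0 0 t = 0" using dtheta1_0_even[OF t] by simp
  qed (use theta_prod_quasi_periodic[OF t] theta_prod_simple_zeros[OF t] in auto)
  then obtain c where c: "\<And>z. k z = c" using doubly_periodic_constant[OF t] by auto
  have "c \<noteq> 0"
  proof
    assume "c = 0"
    then have "dtheta1 0 z t = 0" for z by (simp add: e c)
    then have "dtheta2 0 z t = 0" for z by (simp flip: dtheta_half_shift(1)[OF t])
    then have "dtheta3 0 (z + t / 2) t = 0" for z using dtheta2_eq_dtheta3[OF t, of z] by simp
    then have "dtheta3 0 z t = 0" for z by (metis diff_add_cancel)
    then show False using dtheta3_not_identically_0[OF t] by blast
  qed
  moreover have "dtheta1 0 z t = c * theta_prod t z" for z by (simp add: e c)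
  ultimately show ?thesis using that by blast
qed

lemma simple_zeros_shift:
  assumes g: "simple_zeros t a g" "g holomorphic_on UNIV" and u: "u holomorphic_on UNIV" "\<And>z. u z \<noteq> 0"
    and h: "\<And>z. h z = u z * g (z - b)"
  shows "simple_zeros t (a + b) h"
proof -
  have "deriv h z = u z * deriv g (z - b)" if "h z = 0" for z
  proof -
    have "((\<lambda>z. g (z - b)) has_field_derivative deriv g (z - b)) (at z)"
      using DERIV_shift[of g "deriv g (z - b)" z "- b"] holomorphic_derivI[OF g(2), of "z - b"] by simp
    then have "((\<lambda>z. u z * g (z - b)) has_field_derivative deriv u z * g (z - b) + deriv g (z - b) * u z) (at z)"
      using holomorphic_derivI[OF u(1), of z] by (intro DERIV_mult) auto
    then have "(h has_field_derivative deriv u z * g (z - b) + deriv g (z - b) * u z) (at z)" by (simp flip: h)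
    moreover have "g (z - b) = 0" using that u(2) by (simp add: h)
    ultimately show ?thesis by (simp add: DERIV_imp_deriv)
  qed
  then show ?thesis using g(1) u(2) by (simp add: simple_zeros_def h algebra_simps)
qed

text \<open>The product settles theta_1; each further function is a half-period translate of the
  preceding one times a factor without zeros.\<close>

lemma dtheta_simple_zeros:
  assumes t: "Im t > 0"
  shows "simple_zeros t 0 (\<lambda>z. dtheta1 0 z t)" "simple_zeros t (1 / 2) (\<lambda>z. dtheta2 0 z t)"
    "simple_zeros t (1 / 2 + t / 2) (\<lambda>z. dtheta3 0 z t)" "simple_zeros t (t / 2) (\<lambda>z. dtheta4 0 z t)"
proof -
  note hol = holomorphic_dtheta[OF t, of 0 UNIV]
  obtain c where c: "c \<noteq> 0" "\<And>z. dtheta1 0 z t = c * theta_prod t z" using dtheta1_eq_theta_prod[OF t] by blast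
  have "simple_zeros t (0 + 0) (\<lambda>z. dtheta1 0 z t)"
    by (rule simple_zeros_shift[OF theta_prod_simple_zeros[OF t], where u = "\<lambda>_. c"])
      (use theta_prod_quasi_periodic[OF t] c in \<open>auto simp: quasi_periodic_def\<close>)
  then show 1: "simple_zeros t 0 (\<lambda>z. dtheta1 0 z t)" by simp
  have "simple_zeros t (0 + 1 / 2) (\<lambda>z. dtheta2 0 z t)"
    by (rule simple_zeros_shift[OF 1 hol(1), where u = "\<lambda>_. - 1"])
      (use dtheta_half_shift(2)[OF t, of 0 "z - 1 / 2" for z] in auto)
  then show 2: "simple_zeros t (1 / 2) (\<lambda>z. dtheta2 0 z t)" by simp
  show 3: "simple_zeros t (1 / 2 + t / 2) (\<lambda>z. dtheta3 0 z t)"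
  proof (rule simple_zeros_shift[OF 2 hol(2), where u = "\<lambda>z. 1 / exp (of_real pi * \<i> * (t / 4 + (z - t / 2)))"])
    show "dtheta3 0 z t = 1 / exp (of_real pi * \<i> * (t / 4 + (z - t / 2))) * dtheta2 0 (z - t / 2) t" for z
      by (simp only: dtheta2_eq_dtheta3[OF t, of "z - t / 2"]) simp
  qed (auto intro!: holomorphic_intros)
  have "simple_zeros t (1 / 2 + t / 2 + - (1 / 2)) (\<lambda>z. dtheta4 0 z t)"
    by (rule simple_zeros_shift[OF 3 hol(3), where u = "\<lambda>_. 1"]) (auto simp: dtheta_half_shift(3)[OF t])
  then show "simple_zeros t (t / 2) (\<lambda>z. dtheta4 0 z t)" by simp
qed

lemma half_notin_period_lattice:
  assumes "Im t > 0"
  shows "1 / 2 \<notin> period_lattice t"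
proof
  assume "1 / 2 \<in> period_lattice t"
  then obtain m n where e: "1 / 2 = of_int m + of_int n * t" by (auto simp: period_lattice_def)
  from arg_cong[OF e, of Im] assms have "n = 0" by simp
  with arg_cong[OF e, of Re] have "2 * of_int m = (1 :: real)" by simp
  then have "2 * m = 1" by linarith
  then show False by presburger
qed

lemma half_tau_notin_period_lattice:
  assumes "Im t > 0" "Im a = 0"
  shows "a + t / 2 \<notin> period_lattice t" "- a - t / 2 \<notin> period_lattice t"
proof -
  have False if "real_of_int n * Im t = s * (Im t / 2)" "s = 1 \<or> s = -1" for n s
  proof -
    have "2 * real_of_int n = s" using that assms by (simp add: field_simps)
    then have "2 * n = 1 \<or> 2 * n = -1" using that(2) by linarith
    then show False by presburger
  qed
  from this[of _ 1] this[of _ "-1"] assms show "a + t / 2 \<notin> period_lattice t" "- a - t / 2 \<notin> period_lattice t"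
    by (auto simp: period_lattice_def dest!: arg_cong[where f = Im])
qed

lemma dtheta_0_nonzero:
  assumes t: "Im t > 0"
  shows "dtheta1 1 0 t \<noteq> 0" "dtheta2 0 0 t \<noteq> 0" "dtheta3 0 0 t \<noteq> 0" "dtheta4 0 0 t \<noteq> 0"
proof -
  note z = dtheta_simple_zeros[OF t]
  have "deriv (\<lambda>z. dtheta1 0 z t) 0 \<noteq> 0"
    using z(1) dtheta1_0_even[OF t, of 0] by (auto simp: simple_zeros_def)
  then show "dtheta1 1 0 t \<noteq> 0" using DERIV_imp_deriv[OF dtheta1_dz[OF t, of 0 0]] by simp
  have "- (1 / 2) \<notin> period_lattice t"
  proof
    assume "- (1 / 2) \<in> period_lattice t"
    then have "dtheta1 0 (- (1 / 2)) t = 0" using z(1) by (simp add: simple_zeros_def)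
    then have "dtheta1 0 (1 / 2) t = 0" using dtheta_minus(1)[OF t, of 0 "1/2"] by simp
    then show False using z(1) half_notin_period_lattice[OF t] by (simp add: simple_zeros_def)
  qed
  then show "dtheta2 0 0 t \<noteq> 0" using z(2) by (simp add: simple_zeros_def)
  show "dtheta3 0 0 t \<noteq> 0" "dtheta4 0 0 t \<noteq> 0"
    using z(3,4) half_tau_notin_period_lattice(2)[OF t, of "1/2"] half_tau_notin_period_lattice(2)[OF t, of 0]
    by (auto simp: simple_zeros_def)
qed

section \<open>The third derivative of \<open>\<theta>\<^sub>1\<close> at the origin\<close>

text \<open>The operator w d/dw applied to the logarithm of the product, that is minus the sum of w
  q^n / (1 - w q^n) over n >= 0. Differentiating once more yields the squares in the denominators of
  \<open>eta\<close>.\<close>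

definition qpoch_logderiv :: "complex \<Rightarrow> complex \<Rightarrow> complex" where
  "qpoch_logderiv q w = w * deriv (qpoch q) w / qpoch q w"

lemma qpoch_nonzero_disc:
  assumes "cmod q < 1" "cmod w < 1"
  shows "qpoch q w \<noteq> 0"
proof
  assume "qpoch q w = 0"
  then obtain k where "q ^ k * w = 1" using qpoch_eq_0_iff[OF assms(1)] by blast
  then have "cmod q ^ k * cmod w = 1" by (metis norm_mult norm_power norm_one)
  moreover have "cmod q ^ k * cmod w \<le> cmod w" using assms by (intro mult_left_le_one_le power_le_one) auto
  ultimately show False using assms by simp
qed

lemma holomorphic_qpoch_logderiv:
  assumes "cmod q < 1"
  shows "qpoch_logderiv q holomorphic_on ball 0 1"
  unfolding qpoch_logderiv_def[abs_def]
  using qpoch_nonzero_disc[OF assms]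
  by (intro holomorphic_intros holomorphic_qpoch[OF assms] holomorphic_deriv) auto

lemma qpoch_logderiv_rec:
  assumes q: "cmod q < 1" and w: "cmod w < 1"
  shows "qpoch_logderiv q w = - w / (1 - w) + qpoch_logderiv q (q * w)"
proof -
  have w1: "1 - w \<noteq> 0" using w by auto
  have "cmod (q * w) < 1" using mult_strict_mono'[of "cmod q" 1 "cmod w" 1] q w by (simp add: norm_mult)
  then have n: "qpoch q (q * w) \<noteq> 0" using qpoch_nonzero_disc[OF q] by blast
  show ?thesis
    unfolding qpoch_logderiv_def deriv_qpoch_rec[OF q, of w] qpoch_rec[OF q, of w]
    using w1 n by (simp add: divide_simps) (simp add: algebra_simps)
qed

lemma deriv_qpoch_logderiv_rec:
  assumes q: "cmod q < 1" and w: "cmod w < 1"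
  shows "deriv (qpoch_logderiv q) w = - 1 / (1 - w)\<^sup>2 + q * deriv (qpoch_logderiv q) (q * w)"
proof -
  have w1: "1 - w \<noteq> 0" using w by auto
  have qw: "q * w \<in> ball 0 1" using mult_strict_mono'[of "cmod q" 1 "cmod w" 1] q w by (simp add: norm_mult)
  have "((\<lambda>w. qpoch_logderiv q (q * w)) has_field_derivative deriv (qpoch_logderiv q) (q * w) * q) (at w)"
    by (rule DERIV_chain2[where f = "qpoch_logderiv q" and g = "\<lambda>w. q * w", OF holomorphic_derivI[OF holomorphic_qpoch_logderiv[OF q] open_ball qw]])
      (auto intro!: derivative_eq_intros)
  moreover have "((\<lambda>w. - w / (1 - w)) has_field_derivative - 1 / (1 - w)\<^sup>2) (at w)"
    using w1 by (auto intro!: derivative_eq_intros simp: divide_simps power2_eq_square)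
  ultimately have "((\<lambda>w. - w / (1 - w) + qpoch_logderiv q (q * w)) has_field_derivative
     - 1 / (1 - w)\<^sup>2 + deriv (qpoch_logderiv q) (q * w) * q) (at w)" by (rule DERIV_add[rotated])
  then have "(qpoch_logderiv q has_field_derivative - 1 / (1 - w)\<^sup>2 + deriv (qpoch_logderiv q) (q * w) * q) (at w)"
    by (rule has_field_derivative_transform_within_open[of _ _ _ "ball 0 1"])
      (use w in \<open>auto simp: qpoch_logderiv_rec[OF q]\<close>)
  then show ?thesis by (simp add: DERIV_imp_deriv mult_ac)
qed

text \<open>Telescoping: \<open>B w - B (q * w)\<close> equals -w / (1 - w)^2, taken at w = q^(k+1).
  The far end tends to \<open>B 0\<close>, which is 0.\<close>

lemma lambert_sums:
  assumes q: "cmod q < 1"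
  shows "(\<lambda>k. q ^ Suc k / (1 - q ^ Suc k)\<^sup>2) sums (- q * deriv (qpoch_logderiv q) q)"
proof -
  define B where "B w = w * deriv (qpoch_logderiv q) w" for w
  have qn: "cmod (q ^ Suc n) < 1" for n
    unfolding norm_power using q by (intro power_less_one_iff[THEN iffD2]) auto
  have "(\<Sum>k<n. q ^ Suc k / (1 - q ^ Suc k)\<^sup>2) = B (q ^ Suc n) - B q" for n
  proof (induction n)
    case (Suc n)
    have "B (q ^ Suc n) = - (q ^ Suc n / (1 - q ^ Suc n)\<^sup>2) + B (q * q ^ Suc n)"
      unfolding B_def deriv_qpoch_logderiv_rec[OF q qn] by (simp add: algebra_simps)
    then have "B (q ^ Suc (Suc n)) = q ^ Suc n / (1 - q ^ Suc n)\<^sup>2 + B (q ^ Suc n)" by simp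
    then show ?case using Suc by simp
  qed simp
  moreover have "(\<lambda>n. B (q ^ Suc n) - B q) \<longlonglongrightarrow> 0 - B q"
  proof -
    have "deriv (qpoch_logderiv q) holomorphic_on ball 0 1"
      by (intro holomorphic_deriv holomorphic_qpoch_logderiv q open_ball)
    then have "isCont (deriv (qpoch_logderiv q)) 0"
      by (intro DERIV_isCont[OF holomorphic_derivI[of _ "ball 0 1"]]) auto
    then have "isCont B 0" unfolding B_def[abs_def] by (intro isCont_mult continuous_ident)
    moreover have "(\<lambda>n. q ^ Suc n) \<longlonglongrightarrow> 0" using q by (intro LIMSEQ_Suc LIMSEQ_power_zero)
    ultimately have "(\<lambda>n. B (q ^ Suc n)) \<longlonglongrightarrow> B 0" by (rule isCont_tendsto_compose)
    then show ?thesis by (intro tendsto_intros) (simp add: B_def)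
  qed
  ultimately show ?thesis unfolding sums_def by (simp add: B_def)
qed

lemma eta_eq:
  assumes t: "Im t > 0"
  shows "eta t = 2 * of_real pi ^ 2 * (1 / 24 + nome2 t * deriv (qpoch_logderiv (nome2 t)) (nome2 t))"
proof -
  have "exp (2 * of_nat (Suc k) * of_real pi * \<i> * t) = nome2 t ^ Suc k" for k
    unfolding nome2_power by (simp add: nome2_def mult_ac)
  then show ?thesis using lambert_sums[OF norm_nome2_less_1[OF t]] unfolding eta_def by (simp add: sums_iff)
qed

text \<open>Splitting off the first factor 1 - \<open>nome2 z\<close> leaves a sine times a function
  of the form h(z) h(-z), which suits a Taylor expansion at 0.\<close>

lemma theta_prod_eq_sin:
  assumes t: "Im t > 0"
  shows "theta_prod t z = - 2 * \<i> * (sin (of_real pi * z) * (qpoch (nome2 t) (nome2 (t + z)) * qpoch (nome2 t) (nome2 (t + - z))))"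
proof -
  have 1: "qpoch (nome2 t) (nome2 z) = (1 - nome2 z) * qpoch (nome2 t) (nome2 (t + z))"
    using qpoch_rec[OF norm_nome2_less_1[OF t], of "nome2 z"] by (simp add: nome2_add)
  have 2: "exp (- of_real pi * \<i> * z) * (1 - nome2 z) = - 2 * \<i> * sin (of_real pi * z)"
    unfolding sin_exp_eq right_diff_distrib nome2_def exp_add[symmetric] by (simp add: field_simps exp_minus)
  have "theta_prod t z = (exp (- of_real pi * \<i> * z) * (1 - nome2 z)) *
     (qpoch (nome2 t) (nome2 (t + z)) * qpoch (nome2 t) (nome2 (t + - z)))"
    unfolding theta_prod_def 1 by (simp add: mult_ac)
  then show ?thesis unfolding 2 by (simp add: mult_ac)
qed

lemma higher_deriv_dtheta1:
  assumes "Im t > 0"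
  shows "(deriv ^^ m) (\<lambda>z. dtheta1 0 z t) = (\<lambda>z. dtheta1 m z t)"
proof (induction m)
  case (Suc m)
  then show ?case using DERIV_imp_deriv[OF dtheta1_dz[OF assms, of m]] by auto
qed simp

text \<open>The left side is h^2 (log h)'' at 0. Since (log h)' is 2 pi i times
  \<open>qpoch_logderiv\<close> at \<open>nome2 (t + z)\<close>, a second differentiation
  contributes (2 pi i)^2 = -4 pi^2.\<close>

lemma qpoch_nome2_second_logderiv:
  assumes t: "Im t > 0"
  defines "h \<equiv> \<lambda>z. qpoch (nome2 t) (nome2 (t + z))"
  shows "(deriv ^^ 2) h 0 * h 0 - (deriv h 0)\<^sup>2 = - 4 * of_real pi ^ 2 * (nome2 t * deriv (qpoch_logderiv (nome2 t)) (nome2 t)) * (h 0)\<^sup>2"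
proof -
  define q where "q = nome2 t"
  define A where "A = qpoch_logderiv q"
  \<comment> \<open>On this neighbourhood of 0 the argument \<open>nome2 (t + z)\<close> stays in
    the unit disc, so no division by zero occurs in the logarithmic derivative.\<close>
  define U where "U = {z. Im z > - Im t}"
  have q: "cmod q < 1" using norm_nome2_less_1[OF t] by (simp add: q_def)
  have U: "open U" "0 \<in> U" using t by (auto simp: U_def open_halfspace_Im_gt)
  have disc: "cmod (nome2 (t + z)) < 1" if "z \<in> U" for z
    using that by (intro norm_nome2_less_1) (auto simp: U_def)
  have d: "(h has_field_derivative 2 * of_real pi * \<i> * A (nome2 (t + z)) * h z) (at z)" if z: "z \<in> U" for z
  proof -
    have "(h has_field_derivative deriv (qpoch q) (nome2 (t + z)) * (2 * of_real pi * \<i> * nome2 (t + z))) (at z)"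
      unfolding h_def q_def[symmetric]
      by (rule DERIV_chain2[OF has_field_derivative_qpoch[OF q]]) (auto intro!: derivative_eq_intros)
    then show ?thesis using qpoch_nonzero_disc[OF q disc[OF z]]
      by (simp add: A_def qpoch_logderiv_def h_def q_def mult_ac)
  qed
  have dA: "((\<lambda>z. A (nome2 (t + z))) has_field_derivative deriv A q * (2 * of_real pi * \<i> * q)) (at 0)"
  proof -
    have "(A has_field_derivative deriv A (nome2 (t + 0))) (at (nome2 (t + 0)))"
      unfolding A_def using disc[OF U(2)] by (intro holomorphic_derivI[OF holomorphic_qpoch_logderiv[OF q] open_ball]) auto
    moreover have "((\<lambda>z. nome2 (t + z)) has_field_derivative 2 * of_real pi * \<i> * q) (at 0)"
      by (auto intro!: derivative_eq_intros simp: q_def)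
    ultimately show ?thesis
      using DERIV_chain2[where f = A and g = "\<lambda>z. nome2 (t + z)" and x = 0 and s = UNIV] by (simp add: q_def)
  qed
  have dh: "deriv h z = 2 * of_real pi * \<i> * A (nome2 (t + z)) * h z" if "z \<in> U" for z
    by (rule DERIV_imp_deriv[OF d[OF that]])
  have "((\<lambda>z. 2 * of_real pi * \<i> * A (nome2 (t + z)) * h z) has_field_derivative
     2 * of_real pi * \<i> * (deriv A q * (2 * of_real pi * \<i> * q)) * h 0 + (2 * of_real pi * \<i> * A q * h 0) * (2 * of_real pi * \<i> * A q)) (at 0)"
    using DERIV_mult[OF DERIV_cmult[OF dA, of "2 * of_real pi * \<i>"] d[OF U(2)]] by (simp add: q_def)
  then have "(deriv h has_field_derivative
     2 * of_real pi * \<i> * (deriv A q * (2 * of_real pi * \<i> * q)) * h 0 + (2 * of_real pi * \<i> * A q * h 0) * (2 * of_real pi * \<i> * A q)) (at 0)"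
    by (rule has_field_derivative_transform_within_open[OF _ U]) (simp add: dh)
  then have e1: "(deriv ^^ 2) h 0 = 2 * of_real pi * \<i> * (deriv A q * (2 * of_real pi * \<i> * q)) * h 0 + (2 * of_real pi * \<i> * A q * h 0) * (2 * of_real pi * \<i> * A q)"
    by (simp add: numeral_2_eq_2 DERIV_imp_deriv)
  have e2: "deriv h 0 = 2 * of_real pi * \<i> * A q * h 0" using dh[OF U(2)] by (simp add: q_def)
  show ?thesis unfolding e1 e2 A_def q_def by (simp add: power2_eq_square algebra_simps)
qed

text \<open>In theta_1 = K s S with s(z) = sin(pi z) the values s(0) and s''(0) vanish, so
  theta_1'''/theta_1' = 3 S''/S - pi^2 at 0. Here S''/S = -8 pi^2 b, and pi^2 + 24 pi^2 b is 12
  \<open>eta\<close>.\<close>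

lemma dtheta1_3_eq_eta:
  assumes t: "Im t > 0"
  shows "dtheta1 3 0 t = - 12 * eta t * dtheta1 1 0 t"
proof -
  define h where "h = (\<lambda>z. qpoch (nome2 t) (nome2 (t + z)))"
  define S where "S = (\<lambda>z. h z * h (- z))"
  define s where "s = (\<lambda>z::complex. sin (of_real pi * z))"
  define b where "b = nome2 t * deriv (qpoch_logderiv (nome2 t)) (nome2 t)"
  obtain c where c: "\<And>z. dtheta1 0 z t = c * theta_prod t z" using dtheta1_eq_theta_prod[OF t] by blast
  define K where "K = c * (- 2 * \<i>)"
  have e: "(\<lambda>z. dtheta1 0 z t) = (\<lambda>z. K * (s z * S z))"
    unfolding c theta_prod_eq_sin[OF t] K_def s_def S_def h_def by (simp add: mult.assoc)
  have hh: "h holomorphic_on UNIV"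
    unfolding h_def using holomorphic_on_compose_gen[OF _ holomorphic_qpoch[OF norm_nome2_less_1[OF t], of UNIV], of "\<lambda>z. nome2 (t + z)" UNIV]
    by (simp add: o_def holomorphic_intros)
  have hm: "(\<lambda>z. h (- z)) holomorphic_on UNIV"
    using holomorphic_on_compose_gen[OF _ hh, of uminus UNIV] by (simp add: o_def holomorphic_intros)
  have hS: "S holomorphic_on UNIV" unfolding S_def by (intro holomorphic_intros hh hm)
  have hs: "s holomorphic_on UNIV" unfolding s_def by (intro holomorphic_intros)
  have dhm: "(deriv ^^ n) (\<lambda>z. h (- z)) 0 = (- 1) ^ n * (deriv ^^ n) h 0" for n
    using higher_deriv_compose_linear[OF hh open_UNIV open_UNIV, of 0 "- 1" n] by simp
  have S2: "(deriv ^^ 2) S 0 = 2 * ((deriv ^^ 2) h 0 * h 0 - (deriv h 0)\<^sup>2)"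
    unfolding S_def using higher_deriv_mult[OF hh hm open_UNIV, of 0 2]
    by (simp add: dhm numeral_2_eq_2 power2_eq_square algebra_simps)
  have S2': "(deriv ^^ 2) S 0 = - 8 * of_real pi ^ 2 * b * S 0"
    unfolding S2 h_def qpoch_nome2_second_logderiv[OF t] by (simp add: S_def h_def b_def power2_eq_square)
  have ds: "deriv s = (\<lambda>z. of_real pi * cos (of_real pi * z))"
    unfolding s_def by (intro ext DERIV_imp_deriv) (auto intro!: derivative_eq_intros)
  have ds2: "deriv (\<lambda>z. of_real pi * cos (of_real pi * z)) = (\<lambda>z::complex. - (of_real pi * (of_real pi * s z)))"
    unfolding s_def by (intro ext DERIV_imp_deriv) (auto intro!: derivative_eq_intros simp: power2_eq_square)
  have ds3: "deriv (\<lambda>z::complex. - (of_real pi * (of_real pi * s z))) = (\<lambda>z. - (of_real pi * of_real pi * of_real pi * cos (of_real pi * z)))"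
    unfolding s_def by (intro ext DERIV_imp_deriv) (auto intro!: derivative_eq_intros simp: power2_eq_square power3_eq_cube)
  have s0: "s 0 = 0" by (simp add: s_def)
  have D: "dtheta1 m 0 t = K * (deriv ^^ m) (\<lambda>z. s z * S z) 0" for m
  proof -
    have "dtheta1 m 0 t = (deriv ^^ m) (\<lambda>z. K * (s z * S z)) 0"
      using higher_deriv_dtheta1[OF t, of m] e by metis
    also have "\<dots> = K * (deriv ^^ m) (\<lambda>z. s z * S z) 0"
      by (rule higher_deriv_cmult[of _ UNIV]) (auto intro!: holomorphic_intros hs hS)
    finally show ?thesis .
  qed
  have 1: "dtheta1 1 0 t = K * (of_real pi * S 0)"
    unfolding D using higher_deriv_mult[OF hs hS open_UNIV, of 0 1] by (simp add: ds s0)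
  have "(deriv ^^ 3) (\<lambda>z. s z * S z) 0 = 3 * of_real pi * (deriv ^^ 2) S 0 - of_real pi ^ 3 * S 0"
    using higher_deriv_mult[OF hs hS open_UNIV, of 0 3] by (simp add: numeral_3_eq_3 numeral_2_eq_2 ds ds2 ds3 s0 mult.assoc)
  then have 3: "dtheta1 3 0 t = K * (3 * of_real pi * (- 8 * of_real pi ^ 2 * b * S 0) - of_real pi ^ 3 * S 0)"
    unfolding D S2' by simp
  show ?thesis unfolding 1 3 eta_eq[OF t] b_def[symmetric] by (simp add: field_simps power2_eq_square power3_eq_cube)
qed

section \<open>Wronskians of theta functions\<close>

text \<open>Derivatives are not quasi-periodic along \<open>t\<close>: differentiating
  \<open>theta_mult\<close>, a factor -2 pi i each time, leaves lower-order terms, which the next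
  two combinations are designed to cancel.\<close>

lemma quasi_periodic_deriv:
  assumes f: "quasi_periodic t 1 c d f" and f': "\<And>z. (f has_field_derivative f' z) (at z)"
    and f'': "\<And>z. (f' has_field_derivative f'' z) (at z)"
  shows "f' (z + 1) = c * f' z" "f'' (z + 1) = c * f'' z"
    "f' (z + t) = d * theta_mult t z * (f' z - 2 * of_real pi * \<i> * f z)"
    "f'' (z + t) = d * theta_mult t z * (f'' z - 4 * of_real pi * \<i> * f' z - 4 * of_real pi ^ 2 * f z)"
proof -
  have M: "(theta_mult t has_field_derivative - 2 * of_real pi * \<i> * theta_mult t z) (at z)" for z
    unfolding theta_mult_def[abs_def] by (auto intro!: derivative_eq_intros)
  have sh: "((\<lambda>z. f (z + w)) has_field_derivative f' (z + w)) (at z)" "((\<lambda>z. f' (z + w)) has_field_derivative f'' (z + w)) (at z)" for z w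
    using f' f'' DERIV_shift by blast+
  have 1: "(\<lambda>z. f (z + 1)) = (\<lambda>z. c * f z)" "(\<lambda>z. f (z + t)) = (\<lambda>z. d * theta_mult t z * f z)"
    using f by (auto simp: quasi_periodic_def)
  have d1: "f' (z + 1) = c * f' z" for z
    using DERIV_unique[OF sh(1)[of 1 z, unfolded 1] DERIV_cmult[OF f']] .
  have dt: "f' (z + t) = d * theta_mult t z * (f' z - 2 * of_real pi * \<i> * f z)" for z
    using DERIV_unique[OF sh(1)[of t z, unfolded 1] DERIV_mult[OF DERIV_cmult[OF M] f']] by (simp add: algebra_simps)
  have 2: "(\<lambda>z. f' (z + 1)) = (\<lambda>z. c * f' z)"
    "(\<lambda>z. f' (z + t)) = (\<lambda>z. d * theta_mult t z * (f' z - 2 * of_real pi * \<i> * f z))" using d1 dt by auto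
  show "f' (z + 1) = c * f' z" "f' (z + t) = d * theta_mult t z * (f' z - 2 * of_real pi * \<i> * f z)" by (fact d1 dt)+
  show "f'' (z + 1) = c * f'' z"
    using DERIV_unique[OF sh(2)[of 1 z, unfolded 2] DERIV_cmult[OF f'']] .
  show "f'' (z + t) = d * theta_mult t z * (f'' z - 4 * of_real pi * \<i> * f' z - 4 * of_real pi ^ 2 * f z)"
    using DERIV_unique[OF sh(2)[of t z, unfolded 2] DERIV_mult[OF DERIV_cmult[OF M] DERIV_diff[OF f'' DERIV_cmult[OF f']]]]
    by (simp add: algebra_simps power2_eq_square)
qed

text \<open>The extra terms are the same multiple of f g on both sides of the difference.\<close>

lemma quasi_periodic_wronskian:
  assumes f: "quasi_periodic t 1 c d f" "\<And>z. (f has_field_derivative f' z) (at z)" "\<And>z. (f' has_field_derivative f'' z) (at z)"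
    and g: "quasi_periodic t 1 c' d' g" "\<And>z. (g has_field_derivative g' z) (at z)" "\<And>z. (g' has_field_derivative g'' z) (at z)"
  shows "quasi_periodic t 2 (c * c') (d * d') (\<lambda>z. f' z * g z - g' z * f z)"
proof -
  have "f (z + 1) = c * f z" "f (z + t) = d * theta_mult t z * f z"
    "g (z + 1) = c' * g z" "g (z + t) = d' * theta_mult t z * g z" for z
    using f(1) g(1) by (auto simp: quasi_periodic_def)
  note s = this quasi_periodic_deriv[OF f] quasi_periodic_deriv[OF g]
  have "(\<lambda>z. f' z * g z - g' z * f z) holomorphic_on UNIV"
    by (intro holomorphic_intros holomorphic_on_if_has_field_derivative[OF f(2)] holomorphic_on_if_has_field_derivative[OF f(3)]
        holomorphic_on_if_has_field_derivative[OF g(2)] holomorphic_on_if_has_field_derivative[OF g(3)])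
  then show ?thesis unfolding quasi_periodic_def s by (auto simp: algebra_simps power2_eq_square)
qed

text \<open>The function is f^2 (log f)'', and the logarithm of the automorphy factor is affine in
  \<open>z\<close>, so (log f)'' is doubly periodic.\<close>

lemma quasi_periodic_second_logderiv:
  assumes f: "quasi_periodic t 1 c d f" "\<And>z. (f has_field_derivative f' z) (at z)" "\<And>z. (f' has_field_derivative f'' z) (at z)"
    and f'': "f'' holomorphic_on UNIV"
  shows "quasi_periodic t 2 (c\<^sup>2) (d\<^sup>2) (\<lambda>z. f z * f'' z - (f' z)\<^sup>2)"
proof -
  have "f (z + 1) = c * f z" "f (z + t) = d * theta_mult t z * f z" for z
    using f(1) by (auto simp: quasi_periodic_def)
  note s = this quasi_periodic_deriv[OF f]
  have "(\<lambda>z. f z * f'' z - (f' z)\<^sup>2) holomorphic_on UNIV" (is ?hol)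
    by (intro holomorphic_intros f'' holomorphic_on_if_has_field_derivative[OF f(2)] holomorphic_on_if_has_field_derivative[OF f(3)])
  \<comment> \<open>Pure algebra with p = pi i and r = pi^2: the terms in p v y cancel, and the
    remaining ones carry the factor p^2 + r = 0.\<close>
  have gen: "d * x * y * (d * x * (w - 4 * p * v - 4 * r * y)) - (d * x * (v - 2 * p * y))\<^sup>2 = d\<^sup>2 * x\<^sup>2 * (y * w - v\<^sup>2)"
    if "p * p = - r" for x y w v p r :: complex
  proof -
    have "d * x * y * (d * x * (w - 4 * p * v - 4 * r * y)) - (d * x * (v - 2 * p * y))\<^sup>2
       = d\<^sup>2 * x\<^sup>2 * (y * w - v\<^sup>2) - 4 * d\<^sup>2 * x\<^sup>2 * y\<^sup>2 * (p * p + r)" by (simp add: algebra_simps power2_eq_square)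
    then show ?thesis using that by simp
  qed
  have r: "of_real pi * \<i> * (of_real pi * \<i>) = - (of_real pi ^ 2)" by (simp add: power2_eq_square complex_eq_iff)
  have "d * x * y * (d * x * (w - 4 * of_real pi * \<i> * v - 4 * of_real pi ^ 2 * y)) - (d * x * (v - 2 * of_real pi * \<i> * y))\<^sup>2
     = d\<^sup>2 * x\<^sup>2 * (y * w - v\<^sup>2)" for x y w v :: complex
    using gen[OF r, of x y w v] by (simp only: mult.assoc)
  moreover have "c * x * (c * y) - (c * w)\<^sup>2 = c\<^sup>2 * (x * y - w\<^sup>2)" for x y w by (simp add: algebra_simps power2_eq_square)
  ultimately show ?thesis unfolding quasi_periodic_def s using \<open>?hol\<close> by blast
qed

text \<open>For a period 2w, evenness and translation from -w to w give F(w) = F(-w) and F(w) = e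
  F(-w); if e = -1 then F(w) = 0. The automorphy factor is 1 or -1 at the points used, and its
  square is 1.\<close>

lemma even_quasi_periodic_half_period:
  assumes F: "quasi_periodic t 2 c d F" and even: "\<And>z. F (- z) = F z"
  shows "c = - 1 \<Longrightarrow> F (1 / 2) = 0" "d = - 1 \<Longrightarrow> F (t / 2) = 0" "c * d = - 1 \<Longrightarrow> F (1 / 2 + t / 2) = 0"
proof -
  have p: "F (z + 1) = c * F z" "F (z + t) = d * theta_mult t z ^ 2 * F z" for z
    using F by (auto simp: quasi_periodic_def)
  have m: "theta_mult t (- (t / 2)) = 1" by (simp add: theta_mult_def)
  then have m': "theta_mult t (1 / 2 - t / 2) = - 1" using theta_mult_add_half(1)[of t "- (t / 2)"] by simp
  have z: "x = 0" if "x = - 1 * x" for x :: complex using that by (simp add: eq_neg_iff_add_eq_0)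
  show "F (1 / 2) = 0" if "c = - 1"
    using p(1)[of "- (1 / 2)"] even[of "1 / 2"] that by (intro z) simp
  show "F (t / 2) = 0" if "d = - 1"
    using p(2)[of "- (t / 2)"] even[of "t / 2"] that m by (intro z) simp
  show "F (1 / 2 + t / 2) = 0" if "c * d = - 1"
  proof (rule z)
    have "F (1 / 2 + t / 2) = F ((1 / 2 - t / 2) + t)" by (simp add: field_simps)
    also have "\<dots> = d * F (1 / 2 - t / 2)" unfolding p m' by simp
    also have "F (1 / 2 - t / 2) = F (- (1 / 2 + t / 2) + 1)" by (simp add: field_simps)
    also have "\<dots> = c * F (1 / 2 + t / 2)" unfolding p even by simp
    finally show "F (1 / 2 + t / 2) = - 1 * F (1 / 2 + t / 2)" using that by (simp add: mult_ac)
  qed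
qed

text \<open>The second zero is demanded of the quotient \<open>F / g\<close> rather than of
  \<open>F\<close>, so that the lemma covers both two distinct zeros and a double zero, where g and
  h coincide.\<close>

lemma quasi_periodic_eq_mult:
  assumes t: "Im t > 0" and F: "quasi_periodic t 2 (c * c') (d * d') F" "F a = 0"
    and g: "quasi_periodic t 1 c d g" "c \<noteq> 0" "d \<noteq> 0" "simple_zeros t a g"
    and h: "quasi_periodic t 1 c' d' h" "c' \<noteq> 0" "d' \<noteq> 0" "simple_zeros t b h"
    and b: "\<And>k. k holomorphic_on UNIV \<Longrightarrow> (\<And>z. F z = g z * k z) \<Longrightarrow> k b = 0"
  obtains \<kappa> where "\<And>z. F z = \<kappa> * (g z * h z)"
proof -
  obtain k where k: "quasi_periodic t 1 (c * c' / c) (d * d' / d) k" "\<And>z. F z = g z * k z"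
    using quasi_periodic_divide[of t 1 "c * c'" "d * d'" F a c d g] F g h by (auto simp: numeral_2_eq_2)
  have k0: "k b = 0" by (rule b) (use k in \<open>auto simp: quasi_periodic_def\<close>)
  obtain l where l: "quasi_periodic t 0 (c' / c') (d' / d') l" "\<And>z. k z = h z * l z"
    using quasi_periodic_divide[of t 0 c' d' k b c' d' h] k k0 g h by auto
  obtain \<kappa> where "\<And>z. l z = \<kappa>" using doubly_periodic_constant[OF t, of l] l h by auto
  then show ?thesis using that[of \<kappa>] k l by (simp add: mult_ac)
qed

text \<open>Equals pi by Jacobi's formula; until that is proved it is the unknown constant of the
  three Wronskian identities.\<close>

definition jacobi_ratio :: "complex \<Rightarrow> complex" where
  "jacobi_ratio t = dtheta1 1 0 t / (dtheta2 0 0 t * dtheta3 0 0 t * dtheta4 0 0 t)"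

text \<open>The Wronskian is even with multipliers 1 and -1, so it vanishes at t/2 and 1/2 + t/2,
  zeros of theta_4 and theta_3. The value at 0 fixes the constant.\<close>

lemma wronskian_theta12:
  assumes t: "Im t > 0"
  shows "dtheta1 1 z t * dtheta2 0 z t - dtheta2 1 z t * dtheta1 0 z t
    = jacobi_ratio t * (dtheta2 0 0 t)\<^sup>2 * (dtheta3 0 z t * dtheta4 0 z t)"
proof -
  define F where "F z = dtheta1 1 z t * dtheta2 0 z t - dtheta2 1 z t * dtheta1 0 z t" for z
  note d = dtheta_dz[OF t, of 0, unfolded One_nat_def[symmetric]] and d' = dtheta_dz[OF t, of 1]
  note qp = dtheta_quasi_periodic[OF t] and sz = dtheta_simple_zeros[OF t]
  have qF: "quasi_periodic t 2 (- 1 * - 1) (- 1 * 1) F"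
    unfolding F_def by (rule quasi_periodic_wronskian[OF qp(1) d(1) d'(1) qp(2) d(2) d'(2)])
  have ev: "F (- z) = F z" for z by (simp add: F_def dtheta_minus[OF t])
  note z = even_quasi_periodic_half_period[OF qF ev]
  obtain \<kappa> where k: "\<And>z. F z = \<kappa> * (dtheta4 0 z t * dtheta3 0 z t)"
  proof (rule quasi_periodic_eq_mult[OF t _ _ qp(4) _ _ sz(4) qp(3) _ _ sz(3)])
    fix k assume "\<And>z. F z = dtheta4 0 z t * k z"
    moreover have "dtheta4 0 (1 / 2 + t / 2) t \<noteq> 0"
      using sz(4) half_notin_period_lattice[OF t] by (simp add: simple_zeros_def)
    ultimately show "k (1 / 2 + t / 2) = 0" using z(3) by simp
  qed (use z qF in auto)
  have "F 0 = dtheta1 1 0 t * dtheta2 0 0 t" by (simp add: F_def dtheta1_0_even[OF t])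
  then have "\<kappa> = jacobi_ratio t * (dtheta2 0 0 t)\<^sup>2"
    using k[of 0] dtheta_0_nonzero[OF t] by (simp add: jacobi_ratio_def field_simps power2_eq_square)
  then show ?thesis using k[of z] by (simp add: F_def mult_ac)
qed

text \<open>Multipliers -1 and -1 give zeros at 1/2 and t/2, those of theta_2 and theta_4.\<close>

lemma wronskian_theta13:
  assumes t: "Im t > 0"
  shows "dtheta1 1 z t * dtheta3 0 z t - dtheta3 1 z t * dtheta1 0 z t
    = jacobi_ratio t * (dtheta3 0 0 t)\<^sup>2 * (dtheta2 0 z t * dtheta4 0 z t)"
proof -
  define F where "F z = dtheta1 1 z t * dtheta3 0 z t - dtheta3 1 z t * dtheta1 0 z t" for z
  note d = dtheta_dz[OF t, of 0, unfolded One_nat_def[symmetric]] and d' = dtheta_dz[OF t, of 1]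
  note qp = dtheta_quasi_periodic[OF t] and sz = dtheta_simple_zeros[OF t]
  have qF: "quasi_periodic t 2 (- 1 * 1) (- 1 * 1) F"
    unfolding F_def by (rule quasi_periodic_wronskian[OF qp(1) d(1) d'(1) qp(3) d(3) d'(3)])
  have ev: "F (- z) = F z" for z by (simp add: F_def dtheta_minus[OF t])
  note z = even_quasi_periodic_half_period[OF qF ev]
  obtain \<kappa> where k: "\<And>z. F z = \<kappa> * (dtheta2 0 z t * dtheta4 0 z t)"
  proof (rule quasi_periodic_eq_mult[OF t _ _ qp(2) _ _ sz(2) qp(4) _ _ sz(4)])
    fix k assume "\<And>z. F z = dtheta2 0 z t * k z"
    moreover have "dtheta2 0 (t / 2) t \<noteq> 0"
      using sz(2) half_tau_notin_period_lattice(1)[OF t, of "- (1 / 2)"] by (simp add: simple_zeros_def)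
    ultimately show "k (t / 2) = 0" using z(2) by simp
  qed (use z qF in auto)
  have "F 0 = dtheta1 1 0 t * dtheta3 0 0 t" by (simp add: F_def dtheta1_0_even[OF t])
  then have "\<kappa> = jacobi_ratio t * (dtheta3 0 0 t)\<^sup>2"
    using k[of 0] dtheta_0_nonzero[OF t] by (simp add: jacobi_ratio_def field_simps power2_eq_square)
  then show ?thesis using k[of z] by (simp add: F_def mult_ac)
qed

text \<open>Multipliers -1 and 1 give zeros at 1/2 and 1/2 + t/2, those of theta_2 and
  theta_3.\<close>

lemma wronskian_theta14:
  assumes t: "Im t > 0"
  shows "dtheta1 1 z t * dtheta4 0 z t - dtheta4 1 z t * dtheta1 0 z t
    = jacobi_ratio t * (dtheta4 0 0 t)\<^sup>2 * (dtheta2 0 z t * dtheta3 0 z t)"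
proof -
  define F where "F z = dtheta1 1 z t * dtheta4 0 z t - dtheta4 1 z t * dtheta1 0 z t" for z
  note d = dtheta_dz[OF t, of 0, unfolded One_nat_def[symmetric]] and d' = dtheta_dz[OF t, of 1]
  note qp = dtheta_quasi_periodic[OF t] and sz = dtheta_simple_zeros[OF t]
  have qF: "quasi_periodic t 2 (- 1 * 1) (- 1 * - 1) F"
    unfolding F_def by (rule quasi_periodic_wronskian[OF qp(1) d(1) d'(1) qp(4) d(4) d'(4)])
  have ev: "F (- z) = F z" for z by (simp add: F_def dtheta_minus[OF t])
  note z = even_quasi_periodic_half_period[OF qF ev]
  obtain \<kappa> where k: "\<And>z. F z = \<kappa> * (dtheta2 0 z t * dtheta3 0 z t)"
  proof (rule quasi_periodic_eq_mult[OF t _ _ qp(2) _ _ sz(2) qp(3) _ _ sz(3)])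
    fix k assume "\<And>z. F z = dtheta2 0 z t * k z"
    moreover have "dtheta2 0 (1 / 2 + t / 2) t \<noteq> 0"
      using sz(2) half_tau_notin_period_lattice(1)[OF t, of 0] by (simp add: simple_zeros_def)
    ultimately show "k (1 / 2 + t / 2) = 0" using z(3) by simp
  qed (use z qF in auto)
  have "F 0 = dtheta1 1 0 t * dtheta4 0 0 t" by (simp add: F_def dtheta1_0_even[OF t])
  then have "\<kappa> = jacobi_ratio t * (dtheta4 0 0 t)\<^sup>2"
    using k[of 0] dtheta_0_nonzero[OF t] by (simp add: jacobi_ratio_def field_simps power2_eq_square)
  then show ?thesis using k[of z] by (simp add: F_def mult_ac)
qed

text \<open>The coefficient of theta_2^2 is chosen so that the combination \<open>F\<close> vanishes
  at 0; being even, it vanishes there doubly and is thus a multiple of theta_1^2.\<close>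

lemma theta1_second_logderiv:
  assumes t: "Im t > 0"
  shows "dtheta1 0 z t * dtheta1 2 z t - (dtheta1 1 z t)\<^sup>2
    = dtheta2 2 0 t / dtheta2 0 0 t * (dtheta1 0 z t)\<^sup>2 - (dtheta1 1 0 t / dtheta2 0 0 t)\<^sup>2 * (dtheta2 0 z t)\<^sup>2"
proof -
  define b where "b = (dtheta1 1 0 t / dtheta2 0 0 t)\<^sup>2"
  define G where "G z = dtheta1 0 z t * dtheta1 2 z t - (dtheta1 1 z t)\<^sup>2" for z
  define F where "F z = G z + b * (dtheta2 0 z t)\<^sup>2" for z
  note d = dtheta_dz[OF t, of 0, unfolded One_nat_def[symmetric]] and d' = dtheta_dz[OF t, of 1, unfolded Suc_1]
  note qp = dtheta_quasi_periodic[OF t] and sz = dtheta_simple_zeros[OF t] and nz = dtheta_0_nonzero[OF t]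
  have qG: "quasi_periodic t 2 ((- 1)\<^sup>2) ((- 1)\<^sup>2) G"
    unfolding G_def by (rule quasi_periodic_second_logderiv[OF qp(1) d(1) d'(1) holomorphic_dtheta(1)[OF t]])
  have qF: "quasi_periodic t 2 (- 1 * - 1) (- 1 * - 1) F"
    using qG qp(2) unfolding quasi_periodic_def F_def by (auto intro!: holomorphic_intros simp: algebra_simps power2_eq_square)
  have ev: "F (- z) = F z" for z by (simp add: F_def G_def dtheta_minus[OF t])
  have F0: "F 0 = 0" using nz by (simp add: F_def G_def b_def dtheta1_0_even[OF t] power_divide)
  have dF: "deriv F 0 = 0"
  proof -
    have "F holomorphic_on UNIV" using qF by (simp add: quasi_periodic_def)
    then have D: "(F has_field_derivative deriv F 0) (at 0)" by (rule holomorphic_derivI) auto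
    then have "((\<lambda>z. F (- z)) has_field_derivative deriv F 0 * - 1) (at 0)"
      by (intro DERIV_chain2[of F _ uminus]) (auto intro!: derivative_eq_intros)
    moreover have "(\<lambda>z. F (- z)) = F" using ev by (rule ext)
    ultimately have "(F has_field_derivative deriv F 0 * - 1) (at 0)" by (simp only:)
    from DERIV_unique[OF D this] show ?thesis by (simp add: eq_neg_iff_add_eq_0)
  qed
  obtain \<kappa> where k: "\<And>z. F z = \<kappa> * (dtheta1 0 z t * dtheta1 0 z t)"
  proof (rule quasi_periodic_eq_mult[OF t qF F0 qp(1) _ _ sz(1) qp(1) _ _ sz(1)])
    fix k assume k: "k holomorphic_on UNIV" and Fk: "\<And>z. F z = dtheta1 0 z t * k z"
    have "((\<lambda>z. dtheta1 0 z t * k z) has_field_derivative dtheta1 1 0 t * k 0 + deriv k 0 * dtheta1 0 0 t) (at 0)"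
      by (rule DERIV_mult[OF d(1) holomorphic_derivI[OF k open_UNIV UNIV_I]])
    moreover have "(\<lambda>z. dtheta1 0 z t * k z) = F" using Fk[symmetric] by (rule ext)
    ultimately have "(F has_field_derivative dtheta1 1 0 t * k 0 + deriv k 0 * dtheta1 0 0 t) (at 0)" by (simp only:)
    then have "dtheta1 1 0 t * k 0 = 0" using dF by (simp add: DERIV_imp_deriv dtheta1_0_even[OF t])
    then show "k 0 = 0" using nz by simp
  qed auto
  have "G z = \<kappa> * (dtheta1 0 z t)\<^sup>2 - b * (dtheta2 0 z t)\<^sup>2" for z
    using k[of z] by (simp add: F_def algebra_simps power2_eq_square)
  note G = this
  \<comment> \<open>At 1/2 theta_1 becomes theta_2 and theta_2 becomes -theta_1, which is 0 at the
    origin; only the term with the unknown factor survives.\<close>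
  have "dtheta2 0 0 t * dtheta2 2 0 t = \<kappa> * (dtheta2 0 0 t)\<^sup>2"
    using G[of "0 + 1 / 2"] unfolding G_def dtheta_half_shift[OF t] by (simp add: dtheta1_0_even[OF t] dtheta_0_odd[OF t])
  then have "\<kappa> = dtheta2 2 0 t / dtheta2 0 0 t" using nz by (simp add: field_simps power2_eq_square)
  then show ?thesis using G[of z] by (simp add: G_def b_def)
qed

section \<open>Jacobi's derivative formula\<close>

lemma tendsto_exp_minus_mult_at_top:
  assumes "0 < (c :: real)"
  shows "((\<lambda>y. exp (- (c * y))) \<longlongrightarrow> 0) at_top"
proof (rule filterlim_compose[OF exp_at_bot])
  show "filterlim (\<lambda>y. - (c * y)) at_bot at_top"
    unfolding filterlim_uminus_at_bot[of "\<lambda>y. - (c * y)"]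
    using filterlim_tendsto_pos_mult_at_top[OF tendsto_const assms filterlim_ident] by simp
qed

lemma theta_term_imag_axis:
  "theta_term m a n z (\<i> * of_real y) * of_real (exp (pi * a\<^sup>2 * y))
    = theta_term m a n z 0 * of_real (exp (- (pi * ((of_int n + a)\<^sup>2 - a\<^sup>2) * y)))"
  unfolding theta_term_def exp_of_real[symmetric] mult.assoc exp_add[symmetric]
  by (simp add: algebra_simps power2_eq_square complex_eq_iff Re_exp Im_exp exp_add exp_diff)

text \<open>The normalising factor compensates the slowest decay exp(-pi a^2 y); for these
  \<open>a\<close> no |n + a| is smaller than a. Only terms with |n + a| = a survive, and
  \<open>b\<close> collects them pair by pair. Tannery's theorem exchanges limit and sum.\<close>

lemma theta_char_imag_axis:
  fixes b :: "nat \<Rightarrow> complex"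
  assumes a: "a = 0 \<or> a = 1 / 2"
    and b: "\<And>k. b k = (if (real k + a)\<^sup>2 = a\<^sup>2 then theta_term m a (int k) z 0 else 0) +
       (if (- real k - 1 + a)\<^sup>2 = a\<^sup>2 then theta_term m a (- int k - 1) z 0 else 0)"
  shows "((\<lambda>y. theta_char m a z (\<i> * of_real y) * of_real (exp (pi * a\<^sup>2 * y))) \<longlongrightarrow> suminf b) at_top"
proof -
  define e where "e y = complex_of_real (exp (pi * a\<^sup>2 * y))" for y
  define u where "u k y = theta_term m a (int k) z (\<i> * of_real y) * e y + theta_term m a (- int k - 1) z (\<i> * of_real y) * e y" for k y
  have a01: "0 \<le> a" "a \<le> 1" using a by auto
  have sq: "a\<^sup>2 \<le> (real k + a)\<^sup>2" "a\<^sup>2 \<le> (- real k - 1 + a)\<^sup>2" for k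
  proof -
    show "a\<^sup>2 \<le> (real k + a)\<^sup>2" using a01 by (intro power_mono) auto
    have "a\<^sup>2 \<le> (real k + 1 - a)\<^sup>2" using a by (intro power_mono) auto
    then show "a\<^sup>2 \<le> (- real k - 1 + a)\<^sup>2" using power2_minus[of "real k + 1 - a"] by (simp add: algebra_simps)
  qed
  have lim: "((\<lambda>y. theta_term m a n z (\<i> * of_real y) * e y) \<longlongrightarrow> (if (of_int n + a)\<^sup>2 = a\<^sup>2 then theta_term m a n z 0 else 0)) at_top"
    if "a\<^sup>2 \<le> (of_int n + a)\<^sup>2" for n
  proof (cases "(of_int n + a)\<^sup>2 = a\<^sup>2")
    case True
    then show ?thesis unfolding e_def theta_term_imag_axis by simp
  next
    case False
    then have "0 < pi * ((of_int n + a)\<^sup>2 - a\<^sup>2)" using that by simp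
    from tendsto_mult_right_zero[OF tendsto_of_real[OF tendsto_exp_minus_mult_at_top[OF this], simplified], of "theta_term m a n z 0"]
    show ?thesis using False unfolding e_def theta_term_imag_axis by simp
  qed
  have bnd: "cmod (theta_term m a n z (\<i> * of_real y) * e y) \<le> exp (pi * a\<^sup>2) * cmod (theta_term m a n z \<i>)"
    if "a\<^sup>2 \<le> (of_int n + a)\<^sup>2" "1 \<le> y" for n y
  proof -
    have *: "cmod (theta_term m a n z (\<i> * of_real y) * e y) = cmod (theta_term m a n z 0) * exp (- (pi * ((of_int n + a)\<^sup>2 - a\<^sup>2) * y))" for y
      unfolding e_def theta_term_imag_axis by (simp add: norm_mult)
    \<comment> \<open>The normalised terms decrease in \<open>y\<close>, so their values at y = 1
      dominate.\<close>
    have "cmod (theta_term m a n z (\<i> * of_real y) * e y) \<le> cmod (theta_term m a n z (\<i> * of_real 1) * e 1)"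
      unfolding * using that mult_left_mono[of 1 y "(of_int n + a)\<^sup>2 - a\<^sup>2"] by (intro mult_left_mono) auto
    then show ?thesis by (simp add: norm_mult e_def mult_ac)
  qed
  have "((\<lambda>y. \<Sum>k. u k y) \<longlongrightarrow> suminf b) at_top"
  proof (rule tannerys_theorem[THEN conjunct2, THEN conjunct2])
    fix k
    show "(u k \<longlongrightarrow> b k) at_top"
      unfolding u_def[abs_def] b using lim[of "int k"] lim[of "- int k - 1"] sq[of k] by (intro tendsto_add) auto
  next
    show "summable (\<lambda>k. exp (pi * a\<^sup>2) * theta_bound m (cmod z) 1 k + exp (pi * a\<^sup>2) * theta_bound m (cmod z) 1 k)"
      by (intro summable_add summable_mult summable_theta_bound)
    have *: "cmod (u k y) \<le> exp (pi * a\<^sup>2) * theta_bound m (cmod z) 1 k + exp (pi * a\<^sup>2) * theta_bound m (cmod z) 1 k" if "1 \<le> y" for k y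
    proof -
      have "cmod (theta_term m a (int k) z \<i>) \<le> theta_bound m (cmod z) 1 k" "cmod (theta_term m a (- int k - 1) z \<i>) \<le> theta_bound m (cmod z) 1 k"
        using a01 by (auto intro!: norm_theta_term_nonneg_le norm_theta_term_neg_le)
      then show ?thesis unfolding u_def using bnd[of "int k" y] bnd[of "- int k - 1" y] sq[of k] that
        by (intro order_trans[OF norm_triangle_ineq] add_mono) (auto elim!: order_trans intro!: mult_left_mono)
    qed
    show "\<forall>\<^sub>F (k, y) in at_top \<times>\<^sub>F at_top. cmod (u k y) \<le> exp (pi * a\<^sup>2) * theta_bound m (cmod z) 1 k + exp (pi * a\<^sup>2) * theta_bound m (cmod z) 1 k"
      by (rule eventually_mono[OF eventually_prodI[OF always_eventually[of "\<lambda>_. True"] eventually_ge_at_top[of 1]]]) (use * in auto)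
  qed simp
  moreover have "\<forall>\<^sub>F y in at_top. (\<Sum>k. u k y) = theta_char m a z (\<i> * of_real y) * e y"
    using eventually_gt_at_top[of 0]
  proof eventually_elim
    case (elim y)
    then have "Im (\<i> * of_real y) > 0" by simp
    from suminf_mult2[OF summable_add[OF summable_theta_term[OF this a01, of m z]], of "e y"]
    show ?case by (simp add: u_def theta_char_def distrib_right)
  qed
  ultimately show ?thesis unfolding e_def[symmetric] by (rule Lim_transform_eventually)
qed

lemma dtheta_imag_axis:
  "((\<lambda>y. dtheta3 0 0 (\<i> * of_real y)) \<longlongrightarrow> 1) at_top" "((\<lambda>y. dtheta4 0 0 (\<i> * of_real y)) \<longlongrightarrow> 1) at_top"
  "((\<lambda>y. dtheta2 0 0 (\<i> * of_real y) * of_real (exp (pi * (1 / 2)\<^sup>2 * y))) \<longlongrightarrow> 2) at_top"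
  "((\<lambda>y. dtheta1 1 0 (\<i> * of_real y) * of_real (exp (pi * (1 / 2)\<^sup>2 * y))) \<longlongrightarrow> 2 * of_real pi) at_top"
proof -
  have s0: "(real k + 0)\<^sup>2 = 0\<^sup>2 \<longleftrightarrow> k = 0" "\<not> (- real k - 1 + 0)\<^sup>2 = 0\<^sup>2" for k by auto
  have s1: "(real k + 1 / 2)\<^sup>2 = (1 / 2)\<^sup>2 \<longleftrightarrow> k = 0" "(- real k - 1 + 1 / 2)\<^sup>2 = (1 / 2)\<^sup>2 \<longleftrightarrow> k = 0" for k
    unfolding power2_eq_iff by auto
  have f: "(\<Sum>k. if k = 0 then c else 0) = c" for c :: complex
    using suminf_finite[of "{0::nat}" "\<lambda>k. if k = 0 then c else 0"] by simp
  show "((\<lambda>y. dtheta3 0 0 (\<i> * of_real y)) \<longlongrightarrow> 1) at_top" "((\<lambda>y. dtheta4 0 0 (\<i> * of_real y)) \<longlongrightarrow> 1) at_top"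
    using theta_char_imag_axis[of 0 "\<lambda>k. if k = 0 then theta_term 0 0 0 0 0 else 0" 0 0]
      theta_char_imag_axis[of 0 "\<lambda>k. if k = 0 then theta_term 0 0 0 (1 / 2) 0 else 0" 0 "1 / 2"]
    unfolding s0 f by (auto simp: dtheta_defs theta_term_def)
  have "((\<lambda>y. theta_char m (1 / 2) z (\<i> * of_real y) * of_real (exp (pi * (1 / 2)\<^sup>2 * y))) \<longlongrightarrow>
      theta_term m (1 / 2) 0 z 0 + theta_term m (1 / 2) (- 1) z 0) at_top" for m z
    using theta_char_imag_axis[of "1 / 2" "\<lambda>k. if k = 0 then theta_term m (1 / 2) 0 z 0 + theta_term m (1 / 2) (- 1) z 0 else 0" m z]
    unfolding s1 f by auto
  note l = this
  \<comment> \<open>For theta_1' at 0 the surviving indices 0 and -1 give (pi i)(-i) and (-pi i)(i),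
    hence pi each.\<close>
  have "exp (of_real pi * \<i> * ((- 1 / 2) :: complex)) = - \<i>" "exp (of_real pi * \<i> * ((1 / 2) :: complex)) = \<i>"
    by (auto simp: complex_eq_iff Re_exp Im_exp cos_diff sin_diff)
  then show "((\<lambda>y. dtheta1 1 0 (\<i> * of_real y) * of_real (exp (pi * (1 / 2)\<^sup>2 * y))) \<longlongrightarrow> 2 * of_real pi) at_top"
    using l[of 1 "- 1 / 2"] by (simp add: dtheta_defs theta_term_def)
  show "((\<lambda>y. dtheta2 0 0 (\<i> * of_real y) * of_real (exp (pi * (1 / 2)\<^sup>2 * y))) \<longlongrightarrow> 2) at_top"
    using l[of 0 0] by (simp add: dtheta_defs theta_term_def)
qed

section \<open>Differentiated Wronskian identities and constancy of the Jacobi ratio\<close>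

lemma wronskian_theta12_dz:
  assumes t: "Im t > 0"
  shows "dtheta1 2 z t * dtheta2 0 z t - dtheta2 2 z t * dtheta1 0 z t
    = jacobi_ratio t * (dtheta2 0 0 t)\<^sup>2 * (dtheta3 1 z t * dtheta4 0 z t + dtheta4 1 z t * dtheta3 0 z t)"
proof -
  note d = dtheta_dz[OF t, of 0, unfolded One_nat_def[symmetric]] dtheta_dz[OF t, of 1, unfolded Suc_1]
  from DERIV_unique[OF DERIV_diff[OF DERIV_mult[OF d(5) d(2)] DERIV_mult[OF d(6) d(1)], unfolded wronskian_theta12[OF t]]
    DERIV_cmult[OF DERIV_mult[OF d(3) d(4)]]]
  show ?thesis by (simp add: algebra_simps)
qed

lemma wronskian_theta13_dz:
  assumes t: "Im t > 0"
  shows "dtheta1 2 z t * dtheta3 0 z t - dtheta3 2 z t * dtheta1 0 z t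
    = jacobi_ratio t * (dtheta3 0 0 t)\<^sup>2 * (dtheta2 1 z t * dtheta4 0 z t + dtheta4 1 z t * dtheta2 0 z t)"
proof -
  note d = dtheta_dz[OF t, of 0, unfolded One_nat_def[symmetric]] dtheta_dz[OF t, of 1, unfolded Suc_1]
  from DERIV_unique[OF DERIV_diff[OF DERIV_mult[OF d(5) d(3)] DERIV_mult[OF d(7) d(1)], unfolded wronskian_theta13[OF t]]
    DERIV_cmult[OF DERIV_mult[OF d(2) d(4)]]]
  show ?thesis by (simp add: algebra_simps)
qed

lemma wronskian_theta14_dz:
  assumes t: "Im t > 0"
  shows "dtheta1 2 z t * dtheta4 0 z t - dtheta4 2 z t * dtheta1 0 z t
    = jacobi_ratio t * (dtheta4 0 0 t)\<^sup>2 * (dtheta2 1 z t * dtheta3 0 z t + dtheta3 1 z t * dtheta2 0 z t)"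
proof -
  note d = dtheta_dz[OF t, of 0, unfolded One_nat_def[symmetric]] dtheta_dz[OF t, of 1, unfolded Suc_1]
  from DERIV_unique[OF DERIV_diff[OF DERIV_mult[OF d(5) d(4)] DERIV_mult[OF d(8) d(1)], unfolded wronskian_theta14[OF t]]
    DERIV_cmult[OF DERIV_mult[OF d(2) d(3)]]]
  show ?thesis by (simp add: algebra_simps)
qed

text \<open>The (theta_1, theta_2) identity differentiated twice at 0, where parity removes all
  mixed terms; division by theta_1'(0) theta_2(0) eliminates \<open>jacobi_ratio\<close>.\<close>

lemma dtheta1_3_eq_sum:
  assumes t: "Im t > 0"
  shows "dtheta1 3 0 t / dtheta1 1 0 t
    = dtheta2 2 0 t / dtheta2 0 0 t + dtheta3 2 0 t / dtheta3 0 0 t + dtheta4 2 0 t / dtheta4 0 0 t"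
proof -
  note nz = dtheta_0_nonzero[OF t]
  note d0 = dtheta_dz[OF t, of 0, unfolded One_nat_def[symmetric]] and d1 = dtheta_dz[OF t, of 1, unfolded Suc_1]
  have "Suc 2 = 3" by simp
  note d2 = dtheta_dz[OF t, of 2, unfolded this]
  from DERIV_unique[OF DERIV_diff[OF DERIV_mult[OF d2(1) d0(2)] DERIV_mult[OF d2(2) d0(1)], unfolded wronskian_theta12_dz[OF t]]
    DERIV_cmult[OF DERIV_add[OF DERIV_mult[OF d1(3) d0(4)] DERIV_mult[OF d1(4) d0(3)]]], of 0]
  have "dtheta1 3 0 t * dtheta2 0 0 t - dtheta2 2 0 t * dtheta1 1 0 t
    = jacobi_ratio t * (dtheta2 0 0 t)\<^sup>2 * (dtheta3 2 0 t * dtheta4 0 0 t + dtheta4 2 0 t * dtheta3 0 0 t)"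
    by (simp add: dtheta1_0_even[OF t] dtheta_0_odd[OF t] algebra_simps)
  then show ?thesis using nz by (simp add: jacobi_ratio_def field_simps power2_eq_square)
qed

text \<open>By the heat equation, the preceding identity says that the logarithmic derivative of the ratio in \<open>\<tau>\<close> vanishes.\<close>

lemma jacobi_ratio_has_derivative_0:
  assumes t: "Im t > 0"
  shows "(jacobi_ratio has_field_derivative 0) (at t)"
proof -
  note nz = dtheta_0_nonzero[OF t]
  have s: "Suc (Suc 1) = 3" "Suc (Suc 0) = 2" by auto
  define c where "c = 4 * of_real pi * \<i>"
  have c: "c \<noteq> 0" by (simp add: c_def)
  have D: "((\<lambda>t. dtheta1 1 0 t) has_field_derivative dtheta1 3 0 t / c) (at t)"
    using dtheta_heat(1)[OF t, of 1 0] unfolding s c_def .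
  have V: "((\<lambda>t. dtheta2 0 0 t) has_field_derivative dtheta2 2 0 t / c) (at t)"
      "((\<lambda>t. dtheta3 0 0 t) has_field_derivative dtheta3 2 0 t / c) (at t)"
      "((\<lambda>t. dtheta4 0 0 t) has_field_derivative dtheta4 2 0 t / c) (at t)"
    using dtheta_heat(2-4)[OF t, of 0 0] unfolding s c_def .
  have e: "dtheta1 3 0 t = dtheta1 1 0 t * (dtheta2 2 0 t / dtheta2 0 0 t + dtheta3 2 0 t / dtheta3 0 0 t + dtheta4 2 0 t / dtheta4 0 0 t)"
    using dtheta1_3_eq_sum[OF t] nz(1) by (simp add: field_simps)
  have "(jacobi_ratio has_field_derivative
     (dtheta1 3 0 t / c * (dtheta2 0 0 t * dtheta3 0 0 t * dtheta4 0 0 t) - dtheta1 1 0 t *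
       ((dtheta2 2 0 t / c * dtheta3 0 0 t + dtheta3 2 0 t / c * dtheta2 0 0 t) * dtheta4 0 0 t + dtheta4 2 0 t / c * (dtheta2 0 0 t * dtheta3 0 0 t))) /
     ((dtheta2 0 0 t * dtheta3 0 0 t * dtheta4 0 0 t) * (dtheta2 0 0 t * dtheta3 0 0 t * dtheta4 0 0 t))) (at t)"
    unfolding jacobi_ratio_def[abs_def] using nz by (intro DERIV_divide DERIV_mult D V) auto
  moreover have "dtheta1 3 0 t / c * (dtheta2 0 0 t * dtheta3 0 0 t * dtheta4 0 0 t) - dtheta1 1 0 t *
       ((dtheta2 2 0 t / c * dtheta3 0 0 t + dtheta3 2 0 t / c * dtheta2 0 0 t) * dtheta4 0 0 t + dtheta4 2 0 t / c * (dtheta2 0 0 t * dtheta3 0 0 t)) = 0"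
    unfolding e using nz c by (simp add: field_simps)
  ultimately show ?thesis by simp
qed

theorem jacobi_derivative_formula:
  assumes t: "Im t > 0"
  shows "jacobi_ratio t = of_real pi"
proof -
  have "(jacobi_ratio has_field_derivative 0) (at x within {z. Im z > 0})" if "x \<in> {z. Im z > 0}" for x
    using jacobi_ratio_has_derivative_0[of x] that by (auto intro: has_field_derivative_at_within)
  from has_field_derivative_zero_constant[OF convex_halfspace_Im_gt this]
  obtain c where c: "\<And>x. Im x > 0 \<Longrightarrow> jacobi_ratio x = c" by auto
  \<comment> \<open>Both theta_1' and theta_2 at 0 decay like exp(-pi y/4) along the imaginary axis;
    this factor normalises them and cancels in the ratio.\<close>
  define e where "e y = complex_of_real (exp (pi * (1 / 2)\<^sup>2 * y))" for y
  have "((\<lambda>y. (dtheta1 1 0 (\<i> * of_real y) * e y) / ((dtheta2 0 0 (\<i> * of_real y) * e y) * dtheta3 0 0 (\<i> * of_real y) * dtheta4 0 0 (\<i> * of_real y)))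
     \<longlongrightarrow> 2 * of_real pi / (2 * 1 * 1)) at_top"
    unfolding e_def by (intro tendsto_intros dtheta_imag_axis) auto
  moreover have "\<forall>\<^sub>F y in at_top. (dtheta1 1 0 (\<i> * of_real y) * e y) / ((dtheta2 0 0 (\<i> * of_real y) * e y) * dtheta3 0 0 (\<i> * of_real y) * dtheta4 0 0 (\<i> * of_real y)) = c"
    using eventually_gt_at_top[of 0]
  proof eventually_elim
    case (elim y)
    then have "jacobi_ratio (\<i> * of_real y) = c" by (intro c) simp
    moreover have "e y \<noteq> 0" by (simp add: e_def)
    ultimately show ?case by (simp add: jacobi_ratio_def mult.assoc)
  qed
  ultimately have "((\<lambda>y::real. c) \<longlongrightarrow> 2 * of_real pi / (2 * 1 * 1)) at_top"
    by (rule Lim_transform_eventually)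
  then have "c = 2 * of_real pi / (2 * 1 * 1)"
    by (intro tendsto_unique[OF _ tendsto_const]) auto
  then show ?thesis using c[OF t] by simp
qed

text \<open>The differentiated identities for theta_3 and theta_4, taken at z = 1/2, express their
  ratios of second derivative to value at 0 through that of theta_2; the sum rule with total -12
  \<open>eta\<close> is then one linear equation.\<close>

lemma dtheta2_2_eq_Lambda0:
  assumes t: "Im t > 0"
  shows "dtheta2 2 0 t / dtheta2 0 0 t = - 4 * Lambda0 t"
proof -
  note nz = dtheta_0_nonzero[OF t]
  define D v2 v3 v4 where "D = dtheta1 1 0 t" and "v2 = dtheta2 0 0 t" and "v3 = dtheta3 0 0 t" and "v4 = dtheta4 0 0 t"
  have n: "D \<noteq> 0" "v2 \<noteq> 0" "v3 \<noteq> 0" "v4 \<noteq> 0" using nz by (auto simp: D_def v2_def v3_def v4_def)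
  have D: "D = of_real pi * v2 * v3 * v4"
    using jacobi_derivative_formula[OF t] nz by (simp add: jacobi_ratio_def D_def v2_def v3_def v4_def field_simps)
  have 3: "dtheta2 2 0 t * v4 - dtheta4 2 0 t * v2 = - (of_real pi * v3\<^sup>2 * (D * v3))"
    using wronskian_theta13_dz[OF t, of "0 + 1 / 2"]
    unfolding dtheta_half_shift[OF t] jacobi_derivative_formula[OF t] D_def v2_def v3_def v4_def
    by (simp add: dtheta1_0_even[OF t])
  have 4: "dtheta2 2 0 t * v3 - dtheta3 2 0 t * v2 = - (of_real pi * v4\<^sup>2 * (D * v4))"
    using wronskian_theta14_dz[OF t, of "0 + 1 / 2"]
    unfolding dtheta_half_shift[OF t] jacobi_derivative_formula[OF t] D_def v2_def v3_def v4_def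
    by (simp add: dtheta1_0_even[OF t])
  have a4: "dtheta4 2 0 t / v4 = dtheta2 2 0 t / v2 + of_real pi ^ 2 * v3 ^ 4"
    using 3 n unfolding D by (simp add: divide_simps) (simp add: algebra_simps power2_eq_square power4_eq_xxxx)
  have a3: "dtheta3 2 0 t / v3 = dtheta2 2 0 t / v2 + of_real pi ^ 2 * v4 ^ 4"
    using 4 n unfolding D by (simp add: divide_simps) (simp add: algebra_simps power2_eq_square power4_eq_xxxx)
  have "- 12 * eta t = dtheta1 3 0 t / D" using dtheta1_3_eq_eta[OF t] n by (simp add: D_def)
  also have "\<dots> = dtheta2 2 0 t / v2 + dtheta3 2 0 t / v3 + dtheta4 2 0 t / v4"
    using dtheta1_3_eq_sum[OF t] by (simp add: D_def v2_def v3_def v4_def)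
  finally have "3 * (dtheta2 2 0 t / v2) = - 12 * eta t - of_real pi ^ 2 * (v3 ^ 4 + v4 ^ 4)"
    unfolding a3 a4 by (simp add: algebra_simps)
  then have "dtheta2 2 0 t / v2 = (- 12 * eta t - of_real pi ^ 2 * (v3 ^ 4 + v4 ^ 4)) / 3"
    by (metis nonzero_mult_div_cancel_left zero_neq_numeral)
  also have "\<dots> = - 4 * (eta t + of_real pi ^ 2 / 12 * (v3 ^ 4 + v4 ^ 4))" by (simp add: field_simps)
  finally show ?thesis
    by (simp add: Lambda0_def vtheta3_def vtheta4_def theta3_eq[OF t] theta4_eq[OF t] v2_def v3_def v4_def)
qed

section \<open>The differential equations\<close>

lemma theta1'_eq:
  assumes "Im t > 0"
  shows "theta1' z t = dtheta1 1 z t"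
proof -
  have "(\<lambda>w. theta1 w t) = (\<lambda>w. dtheta1 0 w t)" using theta1_eq[OF assms] by auto
  then show ?thesis using DERIV_imp_deriv[OF dtheta1_dz[OF assms, of 0 z]] by (simp add: theta1'_def)
qed

lemma has_field_derivative_upper_half_plane_cong:
  assumes "Im \<tau> > 0" "\<And>t. Im t > 0 \<Longrightarrow> f t = g t" "(g has_field_derivative D) (at \<tau>)"
  shows "(f has_field_derivative D) (at \<tau>)"
  using assms(3) by (rule has_field_derivative_transform_within_open[where S = "{t. Im t > 0}"])
    (use assms in \<open>auto simp: open_halfspace_Im_gt\<close>)

lemma theta_heat:
  assumes t: "Im t > 0"
  shows "((\<lambda>t. theta1 z t) has_field_derivative - \<i> / (4 * of_real pi) * dtheta1 2 z t) (at t)"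
    "((\<lambda>t. theta2 z t) has_field_derivative - \<i> / (4 * of_real pi) * dtheta2 2 z t) (at t)"
    "((\<lambda>t. theta3 z t) has_field_derivative - \<i> / (4 * of_real pi) * dtheta3 2 z t) (at t)"
    "((\<lambda>t. theta4 z t) has_field_derivative - \<i> / (4 * of_real pi) * dtheta4 2 z t) (at t)"
    "((\<lambda>t. theta1' z t) has_field_derivative - \<i> / (4 * of_real pi) * dtheta1 3 z t) (at t)"
proof -
  have e: "- \<i> / (4 * of_real pi) * x = x / (4 * of_real pi * \<i>)" for x by (simp add: field_simps)
  have s: "Suc (Suc 0) = 2" "Suc (Suc 1) = 3" by auto
  note h = has_field_derivative_upper_half_plane_cong[OF t]
  note d = dtheta_heat[OF t, of 0 z, unfolded s] and d1 = dtheta_heat(1)[OF t, of 1 z, unfolded s]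
  show "((\<lambda>t. theta1 z t) has_field_derivative - \<i> / (4 * of_real pi) * dtheta1 2 z t) (at t)"
    unfolding e by (rule h[OF theta1_eq d(1)])
  show "((\<lambda>t. theta2 z t) has_field_derivative - \<i> / (4 * of_real pi) * dtheta2 2 z t) (at t)"
    unfolding e by (rule h[OF theta2_eq d(2)])
  show "((\<lambda>t. theta3 z t) has_field_derivative - \<i> / (4 * of_real pi) * dtheta3 2 z t) (at t)"
    unfolding e by (rule h[OF theta3_eq d(3)])
  show "((\<lambda>t. theta4 z t) has_field_derivative - \<i> / (4 * of_real pi) * dtheta4 2 z t) (at t)"
    unfolding e by (rule h[OF theta4_eq d(4)])
  show "((\<lambda>t. theta1' z t) has_field_derivative - \<i> / (4 * of_real pi) * dtheta1 3 z t) (at t)"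
    unfolding e by (rule h[OF theta1'_eq d1])
qed

lemma theta_second_logderiv:
  assumes t: "Im t > 0"
  shows "dtheta1 0 z t * dtheta1 2 z t - (dtheta1 1 z t)\<^sup>2
      = - 4 * Lambda0 t * (dtheta1 0 z t)\<^sup>2 - of_real pi ^ 2 * (vtheta3 t)\<^sup>2 * (vtheta4 t)\<^sup>2 * (dtheta2 0 z t)\<^sup>2" (is "?L1 z = ?R1 z")
    and "dtheta2 0 z t * dtheta2 2 z t - (dtheta2 1 z t)\<^sup>2
      = - 4 * Lambda0 t * (dtheta2 0 z t)\<^sup>2 - of_real pi ^ 2 * (vtheta3 t)\<^sup>2 * (vtheta4 t)\<^sup>2 * (dtheta1 0 z t)\<^sup>2"
proof -
  have "dtheta1 1 0 t / dtheta2 0 0 t = of_real pi * vtheta3 t * vtheta4 t"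
    using jacobi_derivative_formula[OF t] dtheta_0_nonzero[OF t]
    by (simp add: jacobi_ratio_def vtheta3_def vtheta4_def theta3_eq[OF t] theta4_eq[OF t] field_simps)
  then have *: "?L1 z = ?R1 z" for z
    using theta1_second_logderiv[OF t, of z] by (simp add: dtheta2_2_eq_Lambda0[OF t] power_mult_distrib)
  show "?L1 z = ?R1 z" by (rule *)
  show "dtheta2 0 z t * dtheta2 2 z t - (dtheta2 1 z t)\<^sup>2
      = - 4 * Lambda0 t * (dtheta2 0 z t)\<^sup>2 - of_real pi ^ 2 * (vtheta3 t)\<^sup>2 * (vtheta4 t)\<^sup>2 * (dtheta1 0 z t)\<^sup>2"
    using *[of "z + 1 / 2"] by (simp add: dtheta_half_shift[OF t])
qed

text \<open>One more derivative in \<open>z\<close>, as the equation for theta_1' involves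
  theta_1'''.\<close>

lemma theta1_second_logderiv_dz:
  assumes t: "Im t > 0"
  shows "dtheta1 0 z t * dtheta1 3 z t - dtheta1 1 z t * dtheta1 2 z t
      = - 8 * Lambda0 t * (dtheta1 0 z t * dtheta1 1 z t) - 2 * of_real pi ^ 2 * (vtheta3 t)\<^sup>2 * (vtheta4 t)\<^sup>2 * (dtheta2 0 z t * dtheta2 1 z t)"
proof -
  have "Suc 2 = 3" by simp
  note d0 = dtheta_dz[OF t, of 0, unfolded One_nat_def[symmetric]] and d1 = dtheta_dz[OF t, of 1, unfolded Suc_1]
    and d2 = dtheta_dz[OF t, of 2, unfolded this]
  from DERIV_unique[OF DERIV_diff[OF DERIV_mult[OF d0(1) d2(1)] DERIV_mult[OF d1(1) d1(1)], folded power2_eq_square, unfolded theta_second_logderiv(1)[OF t], unfolded power2_eq_square]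
    DERIV_diff[OF DERIV_cmult[OF DERIV_mult[OF d0(1) d0(1)]] DERIV_cmult[OF DERIV_mult[OF d0(2) d0(2)]]]]
  show ?thesis by (simp add: algebra_simps power2_eq_square)
qed

theorem theorem4p2:
  fixes \<tau> z :: complex
  assumes "Im \<tau> > 0"
    and "theta1 z \<tau> * theta2 z \<tau> \<noteq> 0"
  shows
   "((\<lambda>t. theta1 z t) has_field_derivative
      (- \<i> / (4 * pi) * theta1' z \<tau> ^ 2 / theta1 z \<tau>
       + \<i> / 4 * pi * vtheta3 \<tau> ^ 2 * vtheta4 \<tau> ^ 2 * theta2 z \<tau> ^ 2 / theta1 z \<tau>
       + \<i> / pi * Lambda0 \<tau> * theta1 z \<tau>)) (at \<tau>)
  \<and> ((\<lambda>t. theta2 z t) has_field_derivative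
      (- \<i> / (4 * pi) * (theta1' z \<tau> / theta1 z \<tau>
           - pi * vtheta2 \<tau> ^ 2 * (theta3 z \<tau> * theta4 z \<tau>) / (theta1 z \<tau> * theta2 z \<tau>)) ^ 2 * theta2 z \<tau>
       + \<i> / 4 * pi * vtheta3 \<tau> ^ 2 * vtheta4 \<tau> ^ 2 * theta1 z \<tau> ^ 2 / theta2 z \<tau>
       + \<i> / pi * Lambda0 \<tau> * theta2 z \<tau>)) (at \<tau>)
  \<and> ((\<lambda>t. theta3 z t) has_field_derivative
      (- \<i> / (4 * pi) * theta1' z \<tau> ^ 2 / theta1 z \<tau> ^ 2 * theta3 z \<tau>
       + \<i> / 2 * vtheta3 \<tau> ^ 2 * theta1' z \<tau> * (theta2 z \<tau> * theta4 z \<tau>) / theta1 z \<tau> ^ 2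
       - \<i> / 4 * pi * vtheta2 \<tau> ^ 2 * vtheta3 \<tau> ^ 2 * theta4 z \<tau> ^ 2 / theta1 z \<tau> ^ 2 * theta3 z \<tau>
       + \<i> / pi * Lambda0 \<tau> * theta3 z \<tau>)) (at \<tau>)
  \<and> ((\<lambda>t. theta4 z t) has_field_derivative
      (- \<i> / (4 * pi) * theta1' z \<tau> ^ 2 / theta1 z \<tau> ^ 2 * theta4 z \<tau>
       + \<i> / 2 * vtheta4 \<tau> ^ 2 * theta1' z \<tau> * (theta2 z \<tau> * theta3 z \<tau>) / theta1 z \<tau> ^ 2
       - \<i> / 4 * pi * vtheta2 \<tau> ^ 2 * vtheta4 \<tau> ^ 2 * theta3 z \<tau> ^ 2 / theta1 z \<tau> ^ 2 * theta4 z \<tau>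
       + \<i> / pi * Lambda0 \<tau> * theta4 z \<tau>)) (at \<tau>)
  \<and> ((\<lambda>t. theta1' z t) has_field_derivative
      (- \<i> / (4 * pi) * theta1' z \<tau> ^ 3 / theta1 z \<tau> ^ 2
       + 3 * \<i> / pi * (pi ^ 2 / 4 * vtheta3 \<tau> ^ 2 * vtheta4 \<tau> ^ 2 * theta2 z \<tau> ^ 2 / theta1 z \<tau> ^ 2
                        + Lambda0 \<tau>) * theta1' z \<tau>
       - \<i> / 2 * pi ^ 2 * vtheta2 \<tau> ^ 2 * vtheta3 \<tau> ^ 2 * vtheta4 \<tau> ^ 2
           * (theta2 z \<tau> * theta3 z \<tau> * theta4 z \<tau>) / theta1 z \<tau> ^ 2)) (at \<tau>)"
proof -
  note t = assms(1)
  define p where "p = complex_of_real pi"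
  define L v2 v3 v4 where "L = Lambda0 \<tau>" and "v2 = vtheta2 \<tau>" and "v3 = vtheta3 \<tau>" and "v4 = vtheta4 \<tau>"
  define x1 x2 x3 x4 y where "x1 = theta1 z \<tau>" and "x2 = theta2 z \<tau>" and "x3 = theta3 z \<tau>" and "x4 = theta4 z \<tau>"
    and "y = theta1' z \<tau>"
  note defs = L_def v2_def v3_def v4_def x1_def x2_def x3_def x4_def y_def p_def
  have nz: "x1 \<noteq> 0" "x2 \<noteq> 0" "p \<noteq> 0" using assms(2) by (auto simp: defs)
  have x: "dtheta1 0 z \<tau> = x1" "dtheta2 0 z \<tau> = x2" "dtheta3 0 z \<tau> = x3" "dtheta4 0 z \<tau> = x4" "dtheta1 1 z \<tau> = y"
    "dtheta2 0 0 \<tau> = v2" "dtheta3 0 0 \<tau> = v3" "dtheta4 0 0 \<tau> = v4"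
    unfolding defs vtheta2_def vtheta3_def vtheta4_def
    using theta1_eq[OF t] theta2_eq[OF t] theta3_eq[OF t] theta4_eq[OF t] theta1'_eq[OF t] by auto
  note w = x jacobi_derivative_formula[OF t, folded p_def]
  \<comment> \<open>The Wronskian identities are solved for the first derivatives, dividing by
    theta_1; the second logarithmic derivatives and the differentiated Wronskians then give every
    higher derivative needed in the heat equation.\<close>
  have y2: "dtheta2 1 z \<tau> = (y * x2 - p * v2\<^sup>2 * (x3 * x4)) / x1"
    using wronskian_theta12[OF t, of z] nz unfolding w by (simp add: field_simps)
  have y3: "dtheta3 1 z \<tau> = (y * x3 - p * v3\<^sup>2 * (x2 * x4)) / x1"
    using wronskian_theta13[OF t, of z] nz unfolding w by (simp add: field_simps)
  have y4: "dtheta4 1 z \<tau> = (y * x4 - p * v4\<^sup>2 * (x2 * x3)) / x1"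
    using wronskian_theta14[OF t, of z] nz unfolding w by (simp add: field_simps)
  have z1: "dtheta1 2 z \<tau> = (y\<^sup>2 - 4 * L * x1\<^sup>2 - p\<^sup>2 * v3\<^sup>2 * v4\<^sup>2 * x2\<^sup>2) / x1"
    using theta_second_logderiv(1)[OF t, of z] nz unfolding x defs(1-4)[symmetric] p_def[symmetric]
    by (simp add: field_simps power2_eq_square)
  have z2: "dtheta2 2 z \<tau> = ((dtheta2 1 z \<tau>)\<^sup>2 - 4 * L * x2\<^sup>2 - p\<^sup>2 * v3\<^sup>2 * v4\<^sup>2 * x1\<^sup>2) / x2"
    using theta_second_logderiv(2)[OF t, of z] nz unfolding x defs(1-4)[symmetric] p_def[symmetric]
    by (simp add: field_simps power2_eq_square)
  have z3: "dtheta3 2 z \<tau> = (dtheta1 2 z \<tau> * x3 - p * v3\<^sup>2 * (dtheta2 1 z \<tau> * x4 + dtheta4 1 z \<tau> * x2)) / x1"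
    using wronskian_theta13_dz[OF t, of z] nz unfolding w by (simp add: field_simps)
  have z4: "dtheta4 2 z \<tau> = (dtheta1 2 z \<tau> * x4 - p * v4\<^sup>2 * (dtheta2 1 z \<tau> * x3 + dtheta3 1 z \<tau> * x2)) / x1"
    using wronskian_theta14_dz[OF t, of z] nz unfolding w by (simp add: field_simps)
  have z5: "dtheta1 3 z \<tau> = (y * dtheta1 2 z \<tau> - 8 * L * (x1 * y) - 2 * p\<^sup>2 * v3\<^sup>2 * v4\<^sup>2 * (x2 * dtheta2 1 z \<tau>)) / x1"
    using theta1_second_logderiv_dz[OF t, of z] nz unfolding x defs(1-4)[symmetric] p_def[symmetric]
    by (simp add: field_simps)
  note h = theta_heat[OF t, of z, folded p_def]
  show ?thesis
  proof (intro conjI)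
    show "((\<lambda>t. theta1 z t) has_field_derivative
      (- \<i> / (4 * pi) * theta1' z \<tau> ^ 2 / theta1 z \<tau>
       + \<i> / 4 * pi * vtheta3 \<tau> ^ 2 * vtheta4 \<tau> ^ 2 * theta2 z \<tau> ^ 2 / theta1 z \<tau>
       + \<i> / pi * Lambda0 \<tau> * theta1 z \<tau>)) (at \<tau>)"
      by (rule DERIV_cong[OF h(1)], unfold z1 of_real_mult of_real_numeral, fold defs)
        (use nz in \<open>simp add: field_simps power2_eq_square\<close>)
    show "((\<lambda>t. theta2 z t) has_field_derivative
      (- \<i> / (4 * pi) * (theta1' z \<tau> / theta1 z \<tau>
           - pi * vtheta2 \<tau> ^ 2 * (theta3 z \<tau> * theta4 z \<tau>) / (theta1 z \<tau> * theta2 z \<tau>)) ^ 2 * theta2 z \<tau>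
       + \<i> / 4 * pi * vtheta3 \<tau> ^ 2 * vtheta4 \<tau> ^ 2 * theta1 z \<tau> ^ 2 / theta2 z \<tau>
       + \<i> / pi * Lambda0 \<tau> * theta2 z \<tau>)) (at \<tau>)"
    proof (rule DERIV_cong[OF h(2)], unfold z2 of_real_mult of_real_numeral, fold defs)
      \<comment> \<open>The expression in braces in the equation for theta_2 is just
        theta_2'/theta_2.\<close>
      have b: "y / x1 - p * v2\<^sup>2 * (x3 * x4) / (x1 * x2) = dtheta2 1 z \<tau> / x2"
        unfolding y2 using nz by (simp add: field_simps)
      show "- \<i> / (4 * p) * (((dtheta2 1 z \<tau>)\<^sup>2 - 4 * L * x2\<^sup>2 - p\<^sup>2 * v3\<^sup>2 * v4\<^sup>2 * x1\<^sup>2) / x2) =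
        - \<i> / (4 * p) * (y / x1 - p * v2\<^sup>2 * (x3 * x4) / (x1 * x2))\<^sup>2 * x2 + \<i> / 4 * p * v3\<^sup>2 * v4\<^sup>2 * x1\<^sup>2 / x2 + \<i> / p * L * x2"
        unfolding b using nz by (simp add: field_simps power2_eq_square)
    qed
    show "((\<lambda>t. theta3 z t) has_field_derivative
      (- \<i> / (4 * pi) * theta1' z \<tau> ^ 2 / theta1 z \<tau> ^ 2 * theta3 z \<tau>
       + \<i> / 2 * vtheta3 \<tau> ^ 2 * theta1' z \<tau> * (theta2 z \<tau> * theta4 z \<tau>) / theta1 z \<tau> ^ 2
       - \<i> / 4 * pi * vtheta2 \<tau> ^ 2 * vtheta3 \<tau> ^ 2 * theta4 z \<tau> ^ 2 / theta1 z \<tau> ^ 2 * theta3 z \<tau>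
       + \<i> / pi * Lambda0 \<tau> * theta3 z \<tau>)) (at \<tau>)"
      by (rule DERIV_cong[OF h(3)], unfold z3 z1 y2 y4 of_real_mult of_real_numeral, fold defs)
        (use nz in \<open>simp add: field_simps power2_eq_square\<close>)
    show "((\<lambda>t. theta4 z t) has_field_derivative
      (- \<i> / (4 * pi) * theta1' z \<tau> ^ 2 / theta1 z \<tau> ^ 2 * theta4 z \<tau>
       + \<i> / 2 * vtheta4 \<tau> ^ 2 * theta1' z \<tau> * (theta2 z \<tau> * theta3 z \<tau>) / theta1 z \<tau> ^ 2
       - \<i> / 4 * pi * vtheta2 \<tau> ^ 2 * vtheta4 \<tau> ^ 2 * theta3 z \<tau> ^ 2 / theta1 z \<tau> ^ 2 * theta4 z \<tau>
       + \<i> / pi * Lambda0 \<tau> * theta4 z \<tau>)) (at \<tau>)"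
      by (rule DERIV_cong[OF h(4)], unfold z4 z1 y2 y3 of_real_mult of_real_numeral, fold defs)
        (use nz in \<open>simp add: field_simps power2_eq_square\<close>)
    show "((\<lambda>t. theta1' z t) has_field_derivative
      (- \<i> / (4 * pi) * theta1' z \<tau> ^ 3 / theta1 z \<tau> ^ 2
       + 3 * \<i> / pi * (pi ^ 2 / 4 * vtheta3 \<tau> ^ 2 * vtheta4 \<tau> ^ 2 * theta2 z \<tau> ^ 2 / theta1 z \<tau> ^ 2
                        + Lambda0 \<tau>) * theta1' z \<tau>
       - \<i> / 2 * pi ^ 2 * vtheta2 \<tau> ^ 2 * vtheta3 \<tau> ^ 2 * vtheta4 \<tau> ^ 2
           * (theta2 z \<tau> * theta3 z \<tau> * theta4 z \<tau>) / theta1 z \<tau> ^ 2)) (at \<tau>)"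
      by (rule DERIV_cong[OF h(5)], unfold z5 z1 y2 of_real_mult of_real_numeral of_real_power of_real_divide, fold defs)
        (use nz in \<open>simp add: field_simps power2_eq_square power3_eq_cube\<close>)
  qed
qed

end
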